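(* (Structural equation) Let $(\mathbb X,\mathbb T)$ be a tangent category with negatives and let $(R,H)$ be an Ehresmann connection on a tangent display map $q\colon E\to M$, with connection forms $\phi=R\iota_q$ and $\psi=\pi_qH$ and curvature form $\mathsf C_{(R,H)}$. Then, for all vector fields $X,Y$ on $E$, $$\mathsf C_{(R,H)}(X,Y)=-[X_H,Y_H]_V,$$ and, as vector-valued differential forms of rank $2$ on $E$, $$\mathsf C_{(R,H)}=\mathsf d\phi+\tfrac12[\phi\wedge\phi]-\left([\phi\wedge\mathrm{id}_{TE}]-[\phi\wedge\psi]_V\right).$$
   Context: Composition is diagrammatic: $fg$ is $f$ followed by $g$; $\langle f,g\rangle$ denotes pairing into a (fibred) product, with projections $\pi_1,\pi_2$. A tangent category $(\mathbb X,\mathbb T)$ is a category $\mathbb X$ with an endofunctor $T$ and natural transformations $p_M\colon TM\to M$, $z_M\colon M\to TM$, $s_M\colon T_2M\to TM$, $l_M\colon TM\to T^2M$, $c_M\colon T^2M\to T^2M$, where the $n$-fold pullback $T_nM$ of $p_M$ along itself exists and is preserved by all $T^m$, such that: $(p_M,z_M,s_M)$ is an additive bundle (a commutative monoid in the category over $M$); $(z_M,l_M)\colon p_M\to Tp_M$ and $(\mathrm{id}_{TM},c_M)\colon Tp_M\to p_{TM}$ are additive bundle morphisms (commutative squares preserving zero and sum); $c_Mc_M=\mathrm{id}$, $l_Mc_M=l_M$, $l_M\,Tl_M=l_M\,l_{TM}$, $Tc_M\,c_{TM}\,Tc_M=c_{TM}\,Tc_M\,c_{TM}$, $l_{TM}\,Tc_M\,c_{TM}=c_M\,Tl_M$;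 and, with $\xi_M=\langle\pi_1l_M,\pi_2z_{TM}\rangle\,Ts_M\colon T_2M\to T^2M$, the square $\xi_M\,Tp_M=\pi_1p_Mz_M$ is a tangent pullback. A tangent pullback is a pullback preserved by $T^m$ for all $m\ge0$. The tangent category has negatives if there is a natural transformation $n_M\colon TM\to TM$ over $M$ with $\langle n_M,\mathrm{id}_{TM}\rangle s_M=p_Mz_M$. A tangent display map is a morphism $q\colon E\to M$ such that for all $n\ge0$ and all $f\colon N\to T^nM$ the pullback of $T^nq$ along $f$ exists and is a tangent pullback. Convention: differential bundles (in the sense of Cockett–Cruttwell) are assumed to have tangent display projections; in particular every $p_M$ is a tangent display map. For a tangent display map $q\colon E\to M$: $Vq$ is the tangent pullback of $Tq$ along $z_M$, with projections $\iota_q\colon Vq\to TE$ and $T^Vq\colon Vq\to M$; $q^V=\iota_qp_E\colon Vq\to E$; $z_q^V\colon E\to Vq$ and $l_q^V\colon Vq\to TVq$ are determined by $z_q^V\iota_q=z_E$, $l_q^V\,T\iota_q=\iota_ql_E$. $Fq$ is the tangent pullback of $q$ along $p_M$, with projections $q^F\colon Fq\to E$, $T^Fq\colon Fq\to TM$, and $l_q^F\colon Fq\to TFq$ is determined by $l_q^F\,Tq^F=q^Fz_E$, $l_q^F\,T(T^Fq)=T^Fq\,l_M$. $\pi_q\colon TE\to Fq$ is the unique morphism with $\pi_qq^F=p_E$, $\pi_q\,T^Fq=Tq$. An Ehresmann connection on $q$ is a pair of $R\colon TE\to Vq$ with $\iota_qR=\mathrm{id}_{Vq}$, $Rq^V=p_E$,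 $Rl_q^V=l_E\,TR$ (a vertical connection) and $H\colon Fq\to TE$ with $H\pi_q=\mathrm{id}_{Fq}$, $Hp_E=q^F$, $Hl_E=l_q^F\,TH$ (a horizontal connection), such that $HR=q^Fz_q^V$ and $\langle R\iota_q,\pi_qH\rangle s_E=\mathrm{id}_{TE}$. A vector field on $E$ is $X\colon E\to TE$ with $Xp_E=\mathrm{id}_E$; $\mathsf{VF}(E)$ denotes the abelian group of vector fields under $X+Y=\langle X,Y\rangle s_E$, with zero $z_E$ and $-X=Xn_E$. For $f\colon N\to T^2E$ with $f\,Tp_E=f\,p_{TE}p_Ez_E$ let $\tilde f\colon N\to T_2E$ be the unique morphism with $\tilde f\xi_E=f$ and set $\{f\}=\tilde f\pi_1$. The Lie bracket is $[X,Y]=\{X\,TY-Y\,TX\,c_E\}$ (difference in $T^2E$ with respect to $s_{TE},n_{TE}$). Given the Ehresmann connection, $X_V=X\phi$ and $X_H=X\psi$ for a vector field $X$; then $X=X_V+X_H$. A (vector-valued) differential form of rank $n\ge1$ on $E$ is a function $\omega\colon\mathsf{VF}(E)^n\to\mathsf{VF}(E)$ additive in each variable and alternating, i.e. $\omega(X_{\sigma(1)},\dots,X_{\sigma(n)})=\mathrm{sgn}(\sigma)\,\omega(X_1,\dots,X_n)$ for all permutations $\sigma$. Its exterior derivative is the rank $n+1$ form $$\mathsf d\omega(X_1,\dots,X_{n+1})=\sum_k(-1)^{k+1}[X_k,\omega(X_1,\dots,\hat X_k,\dots,X_{n+1})]+\sum_{i<j}(-1)^{i+j}\omega([X_i,X_j],X_1,\dots,\hat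 X_i,\dots,\hat X_j,\dots,X_{n+1}).$$ For forms $\omega$, $\tau$ of ranks $n$, $m$, $[\omega\wedge\tau](X_1,\dots,X_{n+m})=\frac1{n!m!}\sum_\sigma\mathrm{sgn}(\sigma)[\omega(X_{\sigma(1)},\dots,X_{\sigma(n)}),\tau(X_{\sigma(n+1)},\dots,X_{\sigma(n+m)})]$, where the factor only signifies that each repeated term is counted once, i.e. the sum is over $(n,m)$-shuffles $\sigma$. The expression $\frac12[\phi\wedge\phi]$ denotes the form $(X,Y)\mapsto[X_V,Y_V]$. The morphisms $\phi,\psi,\mathrm{id}_{TE}$ are regarded as rank $1$ forms $X\mapsto X\phi=X_V$, $X\mapsto X\psi=X_H$, $X\mapsto X$. For a form $\omega$, $\omega_V$ is the form $\omega_V(\dots)=(\omega(\dots))_V$. The curvature form of $(R,H)$ is $\mathsf C_{(R,H)}(X,Y)=\mathsf d\phi(X_H,Y_H)$. *)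

theory Defs
  imports "HOL-Algebra.FiniteProduct" "HOL-Combinatorics.Permutations"
begin

section \<open>Categories and pullbacks\<close>

text \<open>Composition is diagrammatic: \<open>f \<cdot> g\<close> is \<open>f\<close> followed by \<open>g\<close>.\<close>

record ('o, 'm) cat_data =
  Obj :: "'o set"
  Arr :: "'m set"
  src :: "'m \<Rightarrow> 'o"
  tgt :: "'m \<Rightarrow> 'o"
  idm :: "'o \<Rightarrow> 'm"
  cmp :: "'m \<Rightarrow> 'm \<Rightarrow> 'm"  (infixl "\<cdot>\<index>" 70)

definition Hom :: "('o, 'm, 'x) cat_data_scheme \<Rightarrow> 'o \<Rightarrow> 'o \<Rightarrow> 'm set" where
  "Hom C A B = {f \<in> Arr C. src C f = A \<and> tgt C f = B}"

locale category =
  fixes C :: "('o, 'm, 'x) cat_data_scheme" (structure)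
  assumes src_Obj: "f \<in> Arr C \<Longrightarrow> src C f \<in> Obj C"
    and tgt_Obj: "f \<in> Arr C \<Longrightarrow> tgt C f \<in> Obj C"
    and idm_Hom: "A \<in> Obj C \<Longrightarrow> idm C A \<in> Hom C A A"
    and cmp_Hom: "f \<in> Hom C A B \<Longrightarrow> g \<in> Hom C B D \<Longrightarrow> f \<cdot> g \<in> Hom C A D"
    and idm_cmp: "f \<in> Hom C A B \<Longrightarrow> idm C A \<cdot> f = f"
    and cmp_idm: "f \<in> Hom C A B \<Longrightarrow> f \<cdot> idm C B = f"
    and cmp_assoc: "f \<in> Hom C A B \<Longrightarrow> g \<in> Hom C B D \<Longrightarrow> h \<in> Hom C D K
          \<Longrightarrow> (f \<cdot> g) \<cdot> h = f \<cdot> (g \<cdot> h)"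

context
  fixes C :: "('o, 'm, 'x) cat_data_scheme" (structure)
begin

definition is_pullback :: "'m \<Rightarrow> 'm \<Rightarrow> 'o \<Rightarrow> 'm \<Rightarrow> 'm \<Rightarrow> bool" where
  "is_pullback f g P p1 p2 \<longleftrightarrow>
     f \<in> Arr C \<and> g \<in> Arr C \<and> tgt C f = tgt C g \<and>
     p1 \<in> Hom C P (src C f) \<and> p2 \<in> Hom C P (src C g) \<and> p1 \<cdot> f = p2 \<cdot> g \<and>
     (\<forall>N x y. x \<in> Hom C N (src C f) \<and> y \<in> Hom C N (src C g) \<and> x \<cdot> f = y \<cdot> g
        \<longrightarrow> (\<exists>!h. h \<in> Hom C N P \<and> h \<cdot> p1 = x \<and> h \<cdot> p2 = y))"

text \<open>\<open>pair p1 p2 x y\<close> is the pairing of \<open>x\<close> and \<open>y\<close> into the pullback with projections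
  \<open>p1\<close>, \<open>p2\<close>.\<close>

definition pair :: "'m \<Rightarrow> 'm \<Rightarrow> 'm \<Rightarrow> 'm \<Rightarrow> 'm" where
  "pair p1 p2 x y =
     (THE h. h \<in> Hom C (src C x) (src C p1) \<and> h \<cdot> p1 = x \<and> h \<cdot> p2 = y)"

text \<open>\<open>P\<close> is the \<open>n\<close>-fold pullback of \<open>q\<close> along itself, with projections \<open>\<pi> i\<close> for \<open>i < n\<close>
  and diagonal \<open>b\<close> to the base; for \<open>n = 0\<close> this makes \<open>b\<close> an isomorphism.\<close>

definition is_fibre_power :: "nat \<Rightarrow> 'm \<Rightarrow> 'o \<Rightarrow> (nat \<Rightarrow> 'm) \<Rightarrow> 'm \<Rightarrow> bool" where
  "is_fibre_power n q P \<pi> b \<longleftrightarrow>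
     q \<in> Arr C \<and> b \<in> Hom C P (tgt C q) \<and>
     (\<forall>i<n. \<pi> i \<in> Hom C P (src C q) \<and> \<pi> i \<cdot> q = b) \<and>
     (\<forall>N x y. y \<in> Hom C N (tgt C q) \<and> (\<forall>i<n. x i \<in> Hom C N (src C q) \<and> x i \<cdot> q = y)
        \<longrightarrow> (\<exists>!h. h \<in> Hom C N P \<and> h \<cdot> b = y \<and> (\<forall>i<n. h \<cdot> \<pi> i = x i)))"

text \<open>A commutative monoid in the category over \<open>tgt q\<close>: \<open>P\<close>, \<open>p1\<close>, \<open>p2\<close> is the pullback of
  \<open>q\<close> along itself, \<open>z\<close> the zero and \<open>s\<close> the sum. The monoid laws are written for
  generalized elements \<open>a, b, c : N \<rightarrow> E\<close> lying over the same map \<open>N \<rightarrow> M\<close>.\<close>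

definition additive_bundle :: "'m \<Rightarrow> 'o \<Rightarrow> 'm \<Rightarrow> 'm \<Rightarrow> 'm \<Rightarrow> 'm \<Rightarrow> bool" where
  "additive_bundle q P p1 p2 z s \<longleftrightarrow>
     is_pullback q q P p1 p2 \<and>
     z \<in> Hom C (tgt C q) (src C q) \<and> z \<cdot> q = idm C (tgt C q) \<and>
     s \<in> Hom C P (src C q) \<and> s \<cdot> q = p1 \<cdot> q \<and>
     (\<forall>N a. a \<in> Hom C N (src C q) \<longrightarrow> pair p1 p2 (a \<cdot> q \<cdot> z) a \<cdot> s = a) \<and>
     (\<forall>N a b. a \<in> Hom C N (src C q) \<and> b \<in> Hom C N (src C q) \<and> a \<cdot> q = b \<cdot> q
        \<longrightarrow> pair p1 p2 a b \<cdot> s = pair p1 p2 b a \<cdot> s) \<and>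
     (\<forall>N a b c. a \<in> Hom C N (src C q) \<and> b \<in> Hom C N (src C q) \<and> c \<in> Hom C N (src C q)
          \<and> a \<cdot> q = b \<cdot> q \<and> b \<cdot> q = c \<cdot> q
        \<longrightarrow> pair p1 p2 (pair p1 p2 a b \<cdot> s) c \<cdot> s = pair p1 p2 a (pair p1 p2 b c \<cdot> s) \<cdot> s)"

text \<open>\<open>(f, g)\<close> is an additive bundle morphism from \<open>(q, p1, p2, z, s)\<close> to
  \<open>(q', p1', p2', z', s')\<close>; \<open>f\<close> is the map of bases, \<open>g\<close> the map of total spaces.\<close>

definition additive_bundle_morphism ::
  "'m \<times> 'm \<times> 'm \<times> 'm \<times> 'm \<Rightarrow> 'm \<times> 'm \<times> 'm \<times> 'm \<times> 'm \<Rightarrow> 'm \<Rightarrow> 'm \<Rightarrow> bool" where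
  "additive_bundle_morphism = (\<lambda>(q, p1, p2, z, s) (q', p1', p2', z', s') f g.
     f \<in> Hom C (tgt C q) (tgt C q') \<and> g \<in> Hom C (src C q) (src C q') \<and>
     g \<cdot> q' = q \<cdot> f \<and>
     z \<cdot> g = f \<cdot> z' \<and>
     s \<cdot> g = pair p1' p2' (p1 \<cdot> g) (p2 \<cdot> g) \<cdot> s')"

end


section \<open>Tangent categories\<close>

text \<open>\<open>Tob\<close> and \<open>Tar\<close> are the object and arrow parts of the endofunctor \<open>T\<close>; \<open>T2\<close> with
  \<open>T2fst\<close>, \<open>T2snd\<close> is the pullback of \<open>p\<close> along itself that is the domain of the sum;
  \<open>tneg\<close> is the negation.\<close>

record ('o, 'm) tangent_data = "('o, 'm) cat_data" +
  Tob :: "'o \<Rightarrow> 'o"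
  Tar :: "'m \<Rightarrow> 'm"
  tproj :: "'o \<Rightarrow> 'm"
  tzero :: "'o \<Rightarrow> 'm"
  T2 :: "'o \<Rightarrow> 'o"
  T2fst :: "'o \<Rightarrow> 'm"
  T2snd :: "'o \<Rightarrow> 'm"
  tsum :: "'o \<Rightarrow> 'm"
  tlift :: "'o \<Rightarrow> 'm"
  tflip :: "'o \<Rightarrow> 'm"

record ('o, 'm) tangent_neg_data = "('o, 'm) tangent_data" +
  tneg :: "'o \<Rightarrow> 'm"

context
  fixes C :: "('o, 'm, 'x) tangent_data_scheme" (structure)
begin

definition tangent_pullback :: "'m \<Rightarrow> 'm \<Rightarrow> 'o \<Rightarrow> 'm \<Rightarrow> 'm \<Rightarrow> bool" where
  "tangent_pullback f g P p1 p2 \<longleftrightarrow>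
     (\<forall>m. is_pullback C ((Tar C ^^ m) f) ((Tar C ^^ m) g)
            ((Tob C ^^ m) P) ((Tar C ^^ m) p1) ((Tar C ^^ m) p2))"

text \<open>The existence of \<^emph>\<open>one\<close> tangent pullback is enough: pullbacks are unique up to
  isomorphism, so then every pullback of \<open>T\<^sup>n q\<close> along \<open>f\<close> is preserved.\<close>

definition tangent_display_map :: "'m \<Rightarrow> bool" where
  "tangent_display_map q \<longleftrightarrow>
     q \<in> Arr C \<and>
     (\<forall>n N f. f \<in> Hom C N ((Tob C ^^ n) (tgt C q))
        \<longrightarrow> (\<exists>P p1 p2. tangent_pullback ((Tar C ^^ n) q) f P p1 p2))"

definition xi :: "'o \<Rightarrow> 'm" where
  "xi A = pair C (Tar C (T2fst C A)) (Tar C (T2snd C A))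
            (T2fst C A \<cdot> tlift C A) (T2snd C A \<cdot> tzero C (Tob C A)) \<cdot> Tar C (tsum C A)"

text \<open>The additive bundles \<open>p\<close> and \<open>T p\<close>, in the format of \<open>additive_bundle_morphism\<close>.\<close>

definition proj_bundle :: "'o \<Rightarrow> 'm \<times> 'm \<times> 'm \<times> 'm \<times> 'm" where
  "proj_bundle A = (tproj C A, T2fst C A, T2snd C A, tzero C A, tsum C A)"

definition Tproj_bundle :: "'o \<Rightarrow> 'm \<times> 'm \<times> 'm \<times> 'm \<times> 'm" where
  "Tproj_bundle A = (Tar C (tproj C A), Tar C (T2fst C A), Tar C (T2snd C A),
                     Tar C (tzero C A), Tar C (tsum C A))"

end

locale tangent_category = category C
  for C :: "('o, 'm, 'x) tangent_data_scheme" (structure) +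
  assumes T_Obj: "A \<in> Obj C \<Longrightarrow> Tob C A \<in> Obj C"
    and T_Hom: "f \<in> Hom C A B \<Longrightarrow> Tar C f \<in> Hom C (Tob C A) (Tob C B)"
    and T_idm: "A \<in> Obj C \<Longrightarrow> Tar C (idm C A) = idm C (Tob C A)"
    and T_cmp: "f \<in> Hom C A B \<Longrightarrow> g \<in> Hom C B D \<Longrightarrow> Tar C (f \<cdot> g) = Tar C f \<cdot> Tar C g"
    and proj_Hom: "A \<in> Obj C \<Longrightarrow> tproj C A \<in> Hom C (Tob C A) A"
    and lift_Hom: "A \<in> Obj C \<Longrightarrow> tlift C A \<in> Hom C (Tob C A) (Tob C (Tob C A))"
    and flip_Hom: "A \<in> Obj C \<Longrightarrow> tflip C A \<in> Hom C (Tob C (Tob C A)) (Tob C (Tob C A))"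
    and fibre_powers: "A \<in> Obj C \<Longrightarrow>
          \<exists>P \<pi> b. \<forall>m. is_fibre_power C n ((Tar C ^^ m) (tproj C A)) ((Tob C ^^ m) P)
                       (\<lambda>i. (Tar C ^^ m) (\<pi> i)) ((Tar C ^^ m) b)"
    and T2_pullback: "A \<in> Obj C \<Longrightarrow>
          tangent_pullback C (tproj C A) (tproj C A) (T2 C A) (T2fst C A) (T2snd C A)"
    and proj_additive: "A \<in> Obj C \<Longrightarrow>
          additive_bundle C (tproj C A) (T2 C A) (T2fst C A) (T2snd C A) (tzero C A) (tsum C A)"
    and proj_natural: "f \<in> Hom C A B \<Longrightarrow> Tar C f \<cdot> tproj C B = tproj C A \<cdot> f"
    and zero_natural: "f \<in> Hom C A B \<Longrightarrow> f \<cdot> tzero C B = tzero C A \<cdot> Tar C f"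
    and sum_natural: "f \<in> Hom C A B \<Longrightarrow>
          pair C (T2fst C B) (T2snd C B) (T2fst C A \<cdot> Tar C f) (T2snd C A \<cdot> Tar C f) \<cdot> tsum C B
            = tsum C A \<cdot> Tar C f"
    and lift_natural: "f \<in> Hom C A B \<Longrightarrow> Tar C f \<cdot> tlift C B = tlift C A \<cdot> Tar C (Tar C f)"
    and flip_natural: "f \<in> Hom C A B \<Longrightarrow>
          Tar C (Tar C f) \<cdot> tflip C B = tflip C A \<cdot> Tar C (Tar C f)"
    and lift_additive: "A \<in> Obj C \<Longrightarrow>
          additive_bundle_morphism C (proj_bundle C A) (Tproj_bundle C A) (tzero C A) (tlift C A)"
    and flip_additive: "A \<in> Obj C \<Longrightarrow>
          additive_bundle_morphism C (Tproj_bundle C A) (proj_bundle C (Tob C A))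
            (idm C (Tob C A)) (tflip C A)"
    and flip_flip: "A \<in> Obj C \<Longrightarrow> tflip C A \<cdot> tflip C A = idm C (Tob C (Tob C A))"
    and lift_flip: "A \<in> Obj C \<Longrightarrow> tlift C A \<cdot> tflip C A = tlift C A"
    and lift_lift: "A \<in> Obj C \<Longrightarrow>
          tlift C A \<cdot> Tar C (tlift C A) = tlift C A \<cdot> tlift C (Tob C A)"
    and flip_hexagon: "A \<in> Obj C \<Longrightarrow>
          Tar C (tflip C A) \<cdot> tflip C (Tob C A) \<cdot> Tar C (tflip C A)
            = tflip C (Tob C A) \<cdot> Tar C (tflip C A) \<cdot> tflip C (Tob C A)"
    and lift_flip_flip: "A \<in> Obj C \<Longrightarrow>
          tlift C (Tob C A) \<cdot> Tar C (tflip C A) \<cdot> tflip C (Tob C A)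
            = tflip C A \<cdot> Tar C (tlift C A)"
    and lift_universal: "A \<in> Obj C \<Longrightarrow>
          tangent_pullback C (Tar C (tproj C A)) (tzero C A)
            (T2 C A) (xi C A) (T2fst C A \<cdot> tproj C A)"

locale tangent_category_with_negatives = tangent_category C
  for C :: "('o, 'm, 'x) tangent_neg_data_scheme" (structure) +
  assumes neg_Hom: "A \<in> Obj C \<Longrightarrow> tneg C A \<in> Hom C (Tob C A) (Tob C A)"
    and neg_natural: "f \<in> Hom C A B \<Longrightarrow> Tar C f \<cdot> tneg C B = tneg C A \<cdot> Tar C f"
    and neg_proj: "A \<in> Obj C \<Longrightarrow> tneg C A \<cdot> tproj C A = tproj C A"
    and neg_sum: "A \<in> Obj C \<Longrightarrow>
          pair C (T2fst C A) (T2snd C A) (tneg C A) (idm C (Tob C A)) \<cdot> tsum C A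
            = tproj C A \<cdot> tzero C A"


section \<open>Ehresmann connections\<close>

context
  fixes C :: "('o, 'm, 'x) tangent_data_scheme" (structure)
begin

definition fplus :: "'o \<Rightarrow> 'm \<Rightarrow> 'm \<Rightarrow> 'm" where
  "fplus A f g = pair C (T2fst C A) (T2snd C A) f g \<cdot> tsum C A"

text \<open>The bundles \<open>Vq\<close> and \<open>Fq\<close> are determined only up to isomorphism, so their chosen
  projections \<open>\<iota> : Vq \<rightarrow> TE\<close>, \<open>tV : Vq \<rightarrow> M\<close> and \<open>qF : Fq \<rightarrow> E\<close>, \<open>tF : Fq \<rightarrow> TM\<close> are
  parameters in what follows.\<close>

definition vertical_bundle :: "'m \<Rightarrow> 'o \<Rightarrow> 'm \<Rightarrow> 'm \<Rightarrow> bool" where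
  "vertical_bundle q V \<iota> tV \<longleftrightarrow> tangent_pullback C (Tar C q) (tzero C (tgt C q)) V \<iota> tV"

definition horizontal_bundle :: "'m \<Rightarrow> 'o \<Rightarrow> 'm \<Rightarrow> 'm \<Rightarrow> bool" where
  "horizontal_bundle q F qF tF \<longleftrightarrow> tangent_pullback C q (tproj C (tgt C q)) F qF tF"

definition zV :: "'m \<Rightarrow> 'm \<Rightarrow> 'm" where
  "zV q \<iota> = (THE h. h \<in> Hom C (src C q) (src C \<iota>) \<and> h \<cdot> \<iota> = tzero C (src C q))"

definition lV :: "'m \<Rightarrow> 'm \<Rightarrow> 'm" where
  "lV q \<iota> = (THE h. h \<in> Hom C (src C \<iota>) (Tob C (src C \<iota>))
                    \<and> h \<cdot> Tar C \<iota> = \<iota> \<cdot> tlift C (src C q))"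

definition lF :: "'m \<Rightarrow> 'm \<Rightarrow> 'm \<Rightarrow> 'm" where
  "lF q qF tF = (THE h. h \<in> Hom C (src C qF) (Tob C (src C qF))
                    \<and> h \<cdot> Tar C qF = qF \<cdot> tzero C (src C q)
                    \<and> h \<cdot> Tar C tF = tF \<cdot> tlift C (tgt C q))"

definition piq :: "'m \<Rightarrow> 'm \<Rightarrow> 'm \<Rightarrow> 'm" where
  "piq q qF tF = (THE h. h \<in> Hom C (Tob C (src C q)) (src C qF)
                    \<and> h \<cdot> qF = tproj C (src C q) \<and> h \<cdot> tF = Tar C q)"

definition vertical_connection :: "'m \<Rightarrow> 'm \<Rightarrow> 'm \<Rightarrow> bool" where
  "vertical_connection q \<iota> R \<longleftrightarrow>
     R \<in> Hom C (Tob C (src C q)) (src C \<iota>) \<and>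
     \<iota> \<cdot> R = idm C (src C \<iota>) \<and>
     R \<cdot> (\<iota> \<cdot> tproj C (src C q)) = tproj C (src C q) \<and>
     R \<cdot> lV q \<iota> = tlift C (src C q) \<cdot> Tar C R"

definition horizontal_connection :: "'m \<Rightarrow> 'm \<Rightarrow> 'm \<Rightarrow> 'm \<Rightarrow> bool" where
  "horizontal_connection q qF tF H \<longleftrightarrow>
     H \<in> Hom C (src C qF) (Tob C (src C q)) \<and>
     H \<cdot> piq q qF tF = idm C (src C qF) \<and>
     H \<cdot> tproj C (src C q) = qF \<and>
     H \<cdot> tlift C (src C q) = lF q qF tF \<cdot> Tar C H"

definition ehresmann_connection :: "'m \<Rightarrow> 'm \<Rightarrow> 'm \<Rightarrow> 'm \<Rightarrow> 'm \<Rightarrow> 'm \<Rightarrow> bool" where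
  "ehresmann_connection q \<iota> qF tF R H \<longleftrightarrow>
     vertical_connection q \<iota> R \<and> horizontal_connection q qF tF H \<and>
     H \<cdot> R = qF \<cdot> zV q \<iota> \<and>
     fplus (src C q) (R \<cdot> \<iota>) (piq q qF tF \<cdot> H) = idm C (Tob C (src C q))"

end


section \<open>Vector fields and vector-valued differential forms\<close>

text \<open>\<open>omit k Xs\<close> removes the entry with index \<open>k\<close> (counted from 0).\<close>

definition omit :: "nat \<Rightarrow> 'a list \<Rightarrow> 'a list" where
  "omit k Xs = take k Xs @ drop (Suc k) Xs"

definition shuffles :: "nat \<Rightarrow> nat \<Rightarrow> (nat \<Rightarrow> nat) set" where
  "shuffles n m = {\<sigma>. \<sigma> permutes {..<n + m} \<and>
     strict_mono_on {..<n} \<sigma> \<and> strict_mono_on {n..<n + m} \<sigma>}"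

context
  fixes C :: "('o, 'm, 'x) tangent_neg_data_scheme" (structure)
    and E :: 'o
begin

definition VF :: "'m set" where
  "VF = {X \<in> Hom C E (Tob C E). X \<cdot> tproj C E = idm C E}"

text \<open>The abelian group of vector fields, as a multiplicatively written \<open>monoid\<close> record; it
  is used to form finite sums with \<open>finprod\<close>.\<close>

definition VF_group :: "'m monoid" where
  "VF_group = \<lparr>carrier = VF, monoid.mult = fplus C E, one = tzero C E\<rparr>"

text \<open>Intended for \<open>s = 1\<close> and \<open>s = - 1\<close> only.\<close>

definition signed :: "int \<Rightarrow> 'm \<Rightarrow> 'm" where
  "signed s X = (if s = 1 then X else X \<cdot> tneg C E)"

definition brace :: "'m \<Rightarrow> 'm" where
  "brace f = (THE h. h \<in> Hom C (src C f) (T2 C E) \<and> h \<cdot> xi C E = f) \<cdot> T2fst C E"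

definition lie :: "'m \<Rightarrow> 'm \<Rightarrow> 'm" where
  "lie X Y = brace (fplus C (Tob C E) (X \<cdot> Tar C Y)
                     (Y \<cdot> Tar C X \<cdot> tflip C E \<cdot> tneg C (Tob C E)))"

text \<open>Elements of \<open>VF\<^sup>n\<close> are lists of length \<open>n\<close>. A form of rank \<open>n\<close> is made extensional
  (undefined off \<open>VF\<^sup>n\<close>), so that equality of forms is equality of functions.\<close>

definition VFs :: "nat \<Rightarrow> 'm list set" where
  "VFs n = {Xs. length Xs = n \<and> set Xs \<subseteq> VF}"

definition forms :: "nat \<Rightarrow> ('m list \<Rightarrow> 'm) set" where
  "forms n = {\<omega>. 1 \<le> n \<and> \<omega> \<in> VFs n \<rightarrow>\<^sub>E VF \<and>
     (\<forall>Xs \<in> VFs n. \<forall>i<n. \<forall>Y \<in> VF.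
        \<omega> (Xs[i := fplus C E (Xs ! i) Y]) = fplus C E (\<omega> Xs) (\<omega> (Xs[i := Y]))) \<and>
     (\<forall>Xs \<in> VFs n. \<forall>\<sigma>. \<sigma> permutes {..<n} \<longrightarrow>
        \<omega> (permute_list \<sigma> Xs) = signed (sign \<sigma>) (\<omega> Xs))}"

definition form_plus :: "nat \<Rightarrow> ('m list \<Rightarrow> 'm) \<Rightarrow> ('m list \<Rightarrow> 'm) \<Rightarrow> 'm list \<Rightarrow> 'm" where
  "form_plus n \<omega> \<tau> = restrict (\<lambda>Xs. fplus C E (\<omega> Xs) (\<tau> Xs)) (VFs n)"

definition form_minus :: "nat \<Rightarrow> ('m list \<Rightarrow> 'm) \<Rightarrow> ('m list \<Rightarrow> 'm) \<Rightarrow> 'm list \<Rightarrow> 'm" where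
  "form_minus n \<omega> \<tau> = restrict (\<lambda>Xs. fplus C E (\<omega> Xs) (\<tau> Xs \<cdot> tneg C E)) (VFs n)"

text \<open>The rank 1 form \<open>X \<mapsto> X \<cdot> f\<close> of an endomorphism \<open>f\<close> of \<open>TE\<close>.\<close>

definition map_form :: "'m \<Rightarrow> 'm list \<Rightarrow> 'm" where
  "map_form f = restrict (\<lambda>Xs. hd Xs \<cdot> f) (VFs 1)"

text \<open>\<open>\<omega>\<close> is the form followed by \<open>f\<close>; with \<open>f = \<phi>\<close> this is \<open>\<omega>\<^sub>V\<close>.\<close>

definition form_then :: "nat \<Rightarrow> 'm \<Rightarrow> ('m list \<Rightarrow> 'm) \<Rightarrow> 'm list \<Rightarrow> 'm" where
  "form_then n f \<omega> = restrict (\<lambda>Xs. \<omega> Xs \<cdot> f) (VFs n)"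

text \<open>Indices start at 0 here, so \<open>(-1)\<^sup>k\<^sup>+\<^sup>1\<close> of the usual formula becomes \<open>(-1)\<^sup>k\<close>, while
  \<open>(-1)\<^sup>i\<^sup>+\<^sup>j\<close> is unchanged.\<close>

definition ext_deriv :: "nat \<Rightarrow> ('m list \<Rightarrow> 'm) \<Rightarrow> 'm list \<Rightarrow> 'm" where
  "ext_deriv n \<omega> = restrict (\<lambda>Xs. fplus C E
     (finprod VF_group (\<lambda>k. signed ((-1) ^ k) (lie (Xs ! k) (\<omega> (omit k Xs)))) {..n})
     (finprod VF_group
        (\<lambda>(i, j). signed ((-1) ^ (i + j)) (\<omega> (lie (Xs ! i) (Xs ! j) # omit i (omit j Xs))))
        {(i, j). i < j \<and> j \<le> n}))
     (VFs (n + 1))"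

definition wedge :: "nat \<Rightarrow> nat \<Rightarrow> ('m list \<Rightarrow> 'm) \<Rightarrow> ('m list \<Rightarrow> 'm) \<Rightarrow> 'm list \<Rightarrow> 'm" where
  "wedge n m \<omega> \<tau> = restrict (\<lambda>Xs. finprod VF_group
     (\<lambda>\<sigma>. signed (sign \<sigma>)
        (lie (\<omega> (take n (permute_list \<sigma> Xs))) (\<tau> (drop n (permute_list \<sigma> Xs)))))
     (shuffles n m)) (VFs (n + m))"

text \<open>The form written \<open>\<onehalf>[\<phi> \<and> \<phi>]\<close>. There need be no division by 2, so this is by
  definition \<open>(X, Y) \<mapsto> [X \<cdot> \<phi>, Y \<cdot> \<phi>]\<close>.\<close>

definition half_wedge_self :: "'m \<Rightarrow> 'm list \<Rightarrow> 'm" where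
  "half_wedge_self \<phi> = restrict (\<lambda>Xs. lie (Xs ! 0 \<cdot> \<phi>) (Xs ! 1 \<cdot> \<phi>)) (VFs 2)"

end

context
  fixes C :: "('o, 'm, 'x) tangent_neg_data_scheme" (structure)
begin

text \<open>\<open>R \<cdot> \<iota>\<close> and \<open>piq \<cdot> H\<close> are the connection forms \<open>\<phi>\<close> and \<open>\<psi>\<close>.\<close>

definition curvature_form :: "'m \<Rightarrow> 'm \<Rightarrow> 'm \<Rightarrow> 'm \<Rightarrow> 'm \<Rightarrow> 'm \<Rightarrow> 'm list \<Rightarrow> 'm" where
  "curvature_form q \<iota> qF tF R H = restrict
     (\<lambda>Xs. ext_deriv C (src C q) 1 (map_form C (src C q) (R \<cdot> \<iota>))
             [Xs ! 0 \<cdot> (piq C q qF tF \<cdot> H), Xs ! 1 \<cdot> (piq C q qF tF \<cdot> H)])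
     (VFs C (src C q) 2)"

end

end

theory Submission
  imports Defs
begin

text \<open>
  On vector fields the statement is a computation in an abelian group. Write \<open>X = X\<^sub>V + X\<^sub>H\<close> and
  likewise \<open>Y\<close>. Since \<open>\<phi>\<close> kills horizontal fields, only the third term of \<open>d\<phi>(X\<^sub>H, Y\<^sub>H)\<close>
  survives, which gives \<open>- [X\<^sub>H, Y\<^sub>H]\<^sub>V\<close>. For the structural equation, expand every bracket by
  biadditivity into the four brackets of vertical and horizontal parts (\<open>P\<close>, \<open>Q\<close>, \<open>R\<close>, \<open>S\<close> in
  the proof of \<open>structural_equation\<close>); all terms cancel except \<open>- S \<cdot> \<phi>\<close>, provided that the
  bracket of two vertical fields is vertical, that is, \<open>P \<cdot> \<phi> = P\<close>.

  What has to be shown in a tangent category is therefore the following.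

  \<^item> The bracket is biadditive and antisymmetric (\<open>lie_add_right\<close>, \<open>lie_antisym\<close>). The double
    tangent bundle carries two additions, the sum of the bundle \<open>p\<close> and the image under \<open>T\<close> of
    the sum (\<open>tplus\<close>). They satisfy the interchange law (\<open>interchange\<close>), and the canonical flip
    exchanges them (\<open>tplus_flip\<close>). By the universality of the lift, \<open>{f}\<close> is the unique \<open>g\<close> such
    that \<open>f\<close> is the \<open>tplus\<close>-sum of \<open>g \<cdot> l\<close> and the zero vector at \<open>f \<cdot> p\<close>
    (\<open>brace_tplus_lift\<close>, \<open>brace_props\<close>). Both properties of the bracket are obtained by inserting
    these decompositions into the interchange law.

  \<^item> The form \<open>\<phi>\<close> is additive (\<open>linear_additive\<close>): it commutes with the vertical lift, which is
    additive and monic. The form \<open>\<psi>\<close> is then additive because it is \<open>id - \<phi>\<close>.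

  \<^item> Vertical fields are closed under the bracket (\<open>lie_closed_over_zero\<close>): the bracket is
    natural, and a field is vertical iff it lies over the zero field of the base, whose bracket
    with itself is zero.
\<close>

section \<open>Diagram chasing in a category\<close>

context category
begin

lemma Hom_iff [simp]: "f \<in> Hom C A B \<longleftrightarrow> f \<in> Arr C \<and> src C f = A \<and> tgt C f = B"
  by (simp add: Hom_def)

lemma src_in_Obj [simp]: "f \<in> Arr C \<Longrightarrow> src C f \<in> Obj C"
  and tgt_in_Obj [simp]: "f \<in> Arr C \<Longrightarrow> tgt C f \<in> Obj C"
  by (simp_all add: src_Obj tgt_Obj)

lemma idm_typing [simp]:
  assumes "A \<in> Obj C"
  shows "idm C A \<in> Arr C" "src C (idm C A) = A" "tgt C (idm C A) = A"
  using idm_Hom[OF assms] by auto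

lemma cmp_typing [simp]:
  assumes "f \<in> Arr C" "g \<in> Arr C" "tgt C f = src C g"
  shows "f \<cdot> g \<in> Arr C" "src C (f \<cdot> g) = src C f" "tgt C (f \<cdot> g) = tgt C g"
  using cmp_Hom[of f "src C f" "tgt C f" g "tgt C g"] assms by auto

lemma assoc [simp]:
  assumes "f \<in> Arr C" "g \<in> Arr C" "h \<in> Arr C" "tgt C f = src C g" "tgt C g = src C h"
  shows "(f \<cdot> g) \<cdot> h = f \<cdot> (g \<cdot> h)"
  using cmp_assoc[of f "src C f" "tgt C f" g "tgt C g" h "tgt C h"] assms by auto

lemma idm_left [simp]: "f \<in> Arr C \<Longrightarrow> src C f = A \<Longrightarrow> idm C A \<cdot> f = f"
  using idm_cmp[of f A "tgt C f"] by auto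

lemma idm_right [simp]: "f \<in> Arr C \<Longrightarrow> tgt C f = B \<Longrightarrow> f \<cdot> idm C B = f"
  using cmp_idm[of f "src C f" B] by auto

text \<open>Composites are kept in right-associated form, where an equation \<open>f \<cdot> g = k\<close> no longer matches
  when a further factor follows; this form of the equation does.\<close>

lemma cmp_eq_extend:
  assumes "f \<cdot> g = k"
    and "f \<in> Arr C" "g \<in> Arr C" "h \<in> Arr C" "tgt C f = src C g" "tgt C g = src C h"
  shows "f \<cdot> (g \<cdot> h) = k \<cdot> h"
  using assms assoc by metis

lemma is_pullbackD:
  assumes "is_pullback C f g P p1 p2"
  shows "f \<in> Arr C" "g \<in> Arr C" "tgt C f = tgt C g"
    "p1 \<in> Arr C" "src C p1 = P" "tgt C p1 = src C f"
    "p2 \<in> Arr C" "src C p2 = P" "tgt C p2 = src C g" "p1 \<cdot> f = p2 \<cdot> g"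
  using assms by (auto simp: is_pullback_def)

lemma pair_eqs:
  assumes "is_pullback C f g P p1 p2"
    and "x \<in> Arr C" "y \<in> Arr C" "src C x = src C y" "tgt C x = src C f" "tgt C y = src C g"
    and "x \<cdot> f = y \<cdot> g"
  shows "pair C p1 p2 x y \<in> Arr C" "src C (pair C p1 p2 x y) = src C x"
    "tgt C (pair C p1 p2 x y) = P"
    "pair C p1 p2 x y \<cdot> p1 = x" "pair C p1 p2 x y \<cdot> p2 = y"
proof -
  have "\<exists>!h. h \<in> Hom C (src C x) (src C p1) \<and> h \<cdot> p1 = x \<and> h \<cdot> p2 = y"
    using assms unfolding is_pullback_def by (metis Hom_iff)
  from theI'[OF this, folded pair_def] is_pullbackD(5)[OF assms(1)]
  show "pair C p1 p2 x y \<in> Arr C" "src C (pair C p1 p2 x y) = src C x"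
    "tgt C (pair C p1 p2 x y) = P"
    "pair C p1 p2 x y \<cdot> p1 = x" "pair C p1 p2 x y \<cdot> p2 = y"
    by auto
qed

lemma pullback_jointly_monic:
  assumes pb: "is_pullback C f g P p1 p2"
    and h: "h \<in> Arr C" "tgt C h = P" and h': "h' \<in> Arr C" "tgt C h' = P"
    and eq: "h \<cdot> p1 = h' \<cdot> p1" "h \<cdot> p2 = h' \<cdot> p2"
  shows "h = h'"
proof -
  note D = is_pullbackD[OF pb]
  have s: "src C h = src C h'"
    using eq(1) cmp_typing(2)[of h p1] cmp_typing(2)[of h' p1] D h h' by simp
  have "(h \<cdot> p1) \<cdot> f = (h \<cdot> p2) \<cdot> g"
    using D h by simp
  moreover have "h \<cdot> p1 \<in> Hom C (src C h) (src C f)" "h \<cdot> p2 \<in> Hom C (src C h) (src C g)"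
    using D h by simp_all
  ultimately have "\<exists>!k. k \<in> Hom C (src C h) P \<and> k \<cdot> p1 = h \<cdot> p1 \<and> k \<cdot> p2 = h \<cdot> p2"
    using pb unfolding is_pullback_def by blast
  moreover have "h \<in> Hom C (src C h) P" "h' \<in> Hom C (src C h) P"
    using h h' s by auto
  ultimately show ?thesis
    using eq by metis
qed

end


section \<open>The additions on tangent and double tangent bundles\<close>

context tangent_category
begin

lemma tangent_pullback_pullback:
  assumes "tangent_pullback C f g P p1 p2"
  shows "is_pullback C f g P p1 p2"
    and "is_pullback C (Tar C f) (Tar C g) (Tob C P) (Tar C p1) (Tar C p2)"
  using assms[unfolded tangent_pullback_def, rule_format, of 0]
    assms[unfolded tangent_pullback_def, rule_format, of 1] by simp_all

lemma Tob_Obj [simp]: "A \<in> Obj C \<Longrightarrow> Tob C A \<in> Obj C"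
  by (rule T_Obj)

lemma Tar_typing [simp]:
  assumes "f \<in> Arr C"
  shows "Tar C f \<in> Arr C" "src C (Tar C f) = Tob C (src C f)" "tgt C (Tar C f) = Tob C (tgt C f)"
  using T_Hom[of f "src C f" "tgt C f"] assms by auto

lemma Tar_idm [simp]: "A \<in> Obj C \<Longrightarrow> Tar C (idm C A) = idm C (Tob C A)"
  by (rule T_idm)

lemma Tar_cmp [simp]:
  "f \<in> Arr C \<Longrightarrow> g \<in> Arr C \<Longrightarrow> tgt C f = src C g \<Longrightarrow> Tar C (f \<cdot> g) = Tar C f \<cdot> Tar C g"
  using T_cmp[of f "src C f" "tgt C f" g "tgt C g"] by auto

lemma structure_typing [simp]:
  assumes "A \<in> Obj C"
  shows "tproj C A \<in> Arr C" "src C (tproj C A) = Tob C A" "tgt C (tproj C A) = A"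
    "tzero C A \<in> Arr C" "src C (tzero C A) = A" "tgt C (tzero C A) = Tob C A"
    "tlift C A \<in> Arr C" "src C (tlift C A) = Tob C A" "tgt C (tlift C A) = Tob C (Tob C A)"
    "tflip C A \<in> Arr C" "src C (tflip C A) = Tob C (Tob C A)"
    "tgt C (tflip C A) = Tob C (Tob C A)"
    "T2fst C A \<in> Arr C" "src C (T2fst C A) = T2 C A" "tgt C (T2fst C A) = Tob C A"
    "T2snd C A \<in> Arr C" "src C (T2snd C A) = T2 C A" "tgt C (T2snd C A) = Tob C A"
    "tsum C A \<in> Arr C" "src C (tsum C A) = T2 C A" "tgt C (tsum C A) = Tob C A"
    "T2 C A \<in> Obj C"
proof -
  show p: "tproj C A \<in> Arr C" "src C (tproj C A) = Tob C A" "tgt C (tproj C A) = A"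
    using proj_Hom[OF assms] by auto
  show "tlift C A \<in> Arr C" "src C (tlift C A) = Tob C A" "tgt C (tlift C A) = Tob C (Tob C A)"
    using lift_Hom[OF assms] by auto
  show "tflip C A \<in> Arr C" "src C (tflip C A) = Tob C (Tob C A)"
    "tgt C (tflip C A) = Tob C (Tob C A)"
    using flip_Hom[OF assms] by auto
  note D = is_pullbackD[OF tangent_pullback_pullback(1)[OF T2_pullback[OF assms]]]
  show "T2fst C A \<in> Arr C" "src C (T2fst C A) = T2 C A" "tgt C (T2fst C A) = Tob C A"
    "T2snd C A \<in> Arr C" "src C (T2snd C A) = T2 C A" "tgt C (T2snd C A) = Tob C A"
    using D p by auto
  then show "T2 C A \<in> Obj C"
    by (metis src_in_Obj)
  show "tzero C A \<in> Arr C" "src C (tzero C A) = A" "tgt C (tzero C A) = Tob C A"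
    "tsum C A \<in> Arr C" "src C (tsum C A) = T2 C A" "tgt C (tsum C A) = Tob C A"
    using proj_additive[OF assms] p by (auto simp: additive_bundle_def)
qed

lemma proj_nat [simp]:
  assumes "f \<in> Arr C" "tgt C f = B"
  shows "Tar C f \<cdot> tproj C B = tproj C (src C f) \<cdot> f"
  using proj_natural[of f "src C f" B] assms by auto

lemma zero_nat:
  assumes "f \<in> Arr C" "tgt C f = B"
  shows "f \<cdot> tzero C B = tzero C (src C f) \<cdot> Tar C f"
  using zero_natural[of f "src C f" B] assms by auto

lemma lift_nat:
  assumes "f \<in> Arr C" "tgt C f = B"
  shows "Tar C f \<cdot> tlift C B = tlift C (src C f) \<cdot> Tar C (Tar C f)"
  using lift_natural[of f "src C f" B] assms by auto

lemma flip_nat: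
  assumes "f \<in> Arr C" "tgt C f = B"
  shows "Tar C (Tar C f) \<cdot> tflip C B = tflip C (src C f) \<cdot> Tar C (Tar C f)"
  using flip_natural[of f "src C f" B] assms by auto

lemma zero_proj [simp]: "A \<in> Obj C \<Longrightarrow> tzero C A \<cdot> tproj C A = idm C A"
  using proj_additive[of A] by (auto simp: additive_bundle_def)

lemma flip_flip_id [simp]: "A \<in> Obj C \<Longrightarrow> tflip C A \<cdot> tflip C A = idm C (Tob C (Tob C A))"
  by (rule flip_flip)

lemma lift_flip_lift [simp]: "A \<in> Obj C \<Longrightarrow> tlift C A \<cdot> tflip C A = tlift C A"
  by (rule lift_flip)

lemma flip_proj [simp]: "A \<in> Obj C \<Longrightarrow> tflip C A \<cdot> tproj C (Tob C A) = Tar C (tproj C A)"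
  using flip_additive[of A]
  by (auto simp: additive_bundle_morphism_def Tproj_bundle_def proj_bundle_def)

text \<open>The flip is an involution, so each of its compatibilities can be read in both directions.\<close>

lemma flip_Tproj [simp]:
  assumes "A \<in> Obj C" shows "tflip C A \<cdot> Tar C (tproj C A) = tproj C (Tob C A)"
proof -
  have "tflip C A \<cdot> (tflip C A \<cdot> tproj C (Tob C A)) = tproj C (Tob C A)"
    using assms by (simp del: flip_proj flip: assoc)
  then show ?thesis using assms by simp
qed

lemma Tzero_flip [simp]: "A \<in> Obj C \<Longrightarrow> Tar C (tzero C A) \<cdot> tflip C A = tzero C (Tob C A)"
  using flip_additive[of A]
  by (auto simp: additive_bundle_morphism_def Tproj_bundle_def proj_bundle_def)

lemma zero_flip [simp]:
  assumes "A \<in> Obj C" shows "tzero C (Tob C A) \<cdot> tflip C A = Tar C (tzero C A)"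
proof -
  have "Tar C (tzero C A) \<cdot> (tflip C A \<cdot> tflip C A) = tzero C (Tob C A) \<cdot> tflip C A"
    using assms by (simp del: flip_flip_id flip: assoc)
  then show ?thesis using assms by simp
qed

lemma lift_Tproj [simp]:
  "A \<in> Obj C \<Longrightarrow> tlift C A \<cdot> Tar C (tproj C A) = tproj C A \<cdot> tzero C A"
  using lift_additive[of A]
  by (auto simp: additive_bundle_morphism_def Tproj_bundle_def proj_bundle_def)

lemma zero_lift: "A \<in> Obj C \<Longrightarrow> tzero C A \<cdot> tlift C A = tzero C A \<cdot> Tar C (tzero C A)"
  using lift_additive[of A]
  by (auto simp: additive_bundle_morphism_def Tproj_bundle_def proj_bundle_def)

text \<open>The lift is invariant under the flip, which exchanges \<open>p\<close> and \<open>T p\<close>; so its two projections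
  agree.\<close>

lemma lift_proj [simp]:
  assumes "A \<in> Obj C" shows "tlift C A \<cdot> tproj C (Tob C A) = tproj C A \<cdot> tzero C A"
proof -
  have "tlift C A \<cdot> tproj C (Tob C A) = (tlift C A \<cdot> tflip C A) \<cdot> tproj C (Tob C A)"
    using assms by simp
  also have "\<dots> = tlift C A \<cdot> (tflip C A \<cdot> tproj C (Tob C A))"
    using assms by (simp del: lift_flip_lift flip_proj)
  finally show ?thesis using assms by simp
qed

lemma Tzero_Tproj [simp]:
  "A \<in> Obj C \<Longrightarrow> Tar C (tzero C A) \<cdot> Tar C (tproj C A) = idm C (Tob C A)"
  by (simp flip: Tar_cmp)

lemmas structure_extend [simp] =
  cmp_eq_extend[OF Tzero_Tproj]
  cmp_eq_extend[OF proj_nat] cmp_eq_extend[OF zero_proj] cmp_eq_extend[OF flip_flip_id]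
  cmp_eq_extend[OF lift_flip_lift] cmp_eq_extend[OF flip_proj] cmp_eq_extend[OF flip_Tproj]
  cmp_eq_extend[OF Tzero_flip] cmp_eq_extend[OF zero_flip] cmp_eq_extend[OF lift_Tproj]
  cmp_eq_extend[OF lift_proj]

lemmas T2_is_pullback = tangent_pullback_pullback[OF T2_pullback]

lemma fplus_typing [simp]:
  assumes "A \<in> Obj C" "a \<in> Arr C" "b \<in> Arr C" "tgt C a = Tob C A" "tgt C b = Tob C A"
    and "src C a = src C b" and "a \<cdot> tproj C A = b \<cdot> tproj C A"
  shows "fplus C A a b \<in> Arr C" "src C (fplus C A a b) = src C b"
    "tgt C (fplus C A a b) = Tob C A"
  using pair_eqs[OF T2_is_pullback(1)[OF assms(1)], of a b] assms
  by (auto simp: fplus_def)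

lemma fplus_cmp:
  assumes "A \<in> Obj C" "a \<in> Arr C" "b \<in> Arr C" "tgt C a = Tob C A" "tgt C b = Tob C A"
    and "src C a = src C b" and "a \<cdot> tproj C A = b \<cdot> tproj C A"
    and "h \<in> Arr C" "tgt C h = src C a"
  shows "h \<cdot> fplus C A a b = fplus C A (h \<cdot> a) (h \<cdot> b)"
proof -
  note P = pair_eqs[OF T2_is_pullback(1)[OF assms(1)], of a b]
    pair_eqs[OF T2_is_pullback(1)[OF assms(1)], of "h \<cdot> a" "h \<cdot> b"]
  have "h \<cdot> pair C (T2fst C A) (T2snd C A) a b
      = pair C (T2fst C A) (T2snd C A) (h \<cdot> a) (h \<cdot> b)"
    by (rule pullback_jointly_monic[OF T2_is_pullback(1)[OF assms(1)]])
      (use P assms in simp_all)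
  then show ?thesis
    using P assms by (simp add: fplus_def flip: assoc)
qed


lemma fplus_proj [simp]:
  assumes "A \<in> Obj C" "a \<in> Arr C" "b \<in> Arr C" "tgt C a = Tob C A" "tgt C b = Tob C A"
    and "src C a = src C b" and "a \<cdot> tproj C A = b \<cdot> tproj C A"
  shows "fplus C A a b \<cdot> tproj C A = b \<cdot> tproj C A"
proof -
  note P = pair_eqs[OF T2_is_pullback(1)[OF assms(1)], of a b]
  have "tsum C A \<cdot> tproj C A = T2fst C A \<cdot> tproj C A"
    using proj_additive[OF assms(1)] by (auto simp: additive_bundle_def)
  moreover have "pair C (T2fst C A) (T2snd C A) a b \<cdot> (T2fst C A \<cdot> tproj C A) = a \<cdot> tproj C A"
    using P assms by (simp add: cmp_eq_extend[OF P(4)])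
  ultimately show ?thesis
    using P assms by (simp add: fplus_def)
qed

lemma fplus_zero_left:
  assumes "A \<in> Obj C" "a \<in> Arr C" "tgt C a = Tob C A"
  shows "fplus C A (a \<cdot> (tproj C A \<cdot> tzero C A)) a = a"
proof -
  have "\<forall>N a. a \<in> Hom C N (src C (tproj C A)) \<longrightarrow> fplus C A (a \<cdot> tproj C A \<cdot> tzero C A) a = a"
    using proj_additive[OF assms(1)] unfolding additive_bundle_def fplus_def by blast
  then have "fplus C A ((a \<cdot> tproj C A) \<cdot> tzero C A) a = a"
    using assms by simp
  then show ?thesis using assms by simp
qed

lemma fplus_commute:
  assumes "A \<in> Obj C" "a \<in> Arr C" "b \<in> Arr C" "tgt C a = Tob C A" "tgt C b = Tob C A"
    and "src C a = src C b" and "a \<cdot> tproj C A = b \<cdot> tproj C A"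
  shows "fplus C A a b = fplus C A b a"
  using proj_additive[OF assms(1)] assms unfolding additive_bundle_def fplus_def by simp

lemma fplus_zero_right:
  assumes "A \<in> Obj C" "a \<in> Arr C" "tgt C a = Tob C A"
  shows "fplus C A a (a \<cdot> (tproj C A \<cdot> tzero C A)) = a"
  using fplus_zero_left[OF assms] fplus_commute[of A a "a \<cdot> (tproj C A \<cdot> tzero C A)"] assms
  by simp

lemma fplus_assoc:
  assumes "A \<in> Obj C" "a \<in> Arr C" "b \<in> Arr C" "c \<in> Arr C"
    and "tgt C a = Tob C A" "tgt C b = Tob C A" "tgt C c = Tob C A"
    and "src C a = src C b" "src C b = src C c"
    and "a \<cdot> tproj C A = b \<cdot> tproj C A" "b \<cdot> tproj C A = c \<cdot> tproj C A"
  shows "fplus C A (fplus C A a b) c = fplus C A a (fplus C A b c)"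
  using proj_additive[OF assms(1)] assms unfolding additive_bundle_def fplus_def by simp

text \<open>Naturality of the sum, for generalized elements.\<close>

lemma fplus_Tar:
  assumes "A \<in> Obj C" "a \<in> Arr C" "b \<in> Arr C" "tgt C a = Tob C A" "tgt C b = Tob C A"
    and "src C a = src C b" and "a \<cdot> tproj C A = b \<cdot> tproj C A"
    and f: "f \<in> Arr C" "src C f = A" "tgt C f = B"
  shows "fplus C A a b \<cdot> Tar C f = fplus C B (a \<cdot> Tar C f) (b \<cdot> Tar C f)"
proof -
  note P = pair_eqs[OF T2_is_pullback(1)[OF assms(1)], of a b]
  have B: "B \<in> Obj C" using f by auto
  have eq: "T2fst C A \<cdot> tproj C A = T2snd C A \<cdot> tproj C A"
    using is_pullbackD(10)[OF T2_is_pullback(1)[OF assms(1)]] .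
  then have "T2fst C A \<cdot> (tproj C A \<cdot> f) = T2snd C A \<cdot> (tproj C A \<cdot> f)"
    using assms by (simp flip: assoc)
  then have "pair C (T2fst C A) (T2snd C A) a b
      \<cdot> fplus C B (T2fst C A \<cdot> Tar C f) (T2snd C A \<cdot> Tar C f)
    = fplus C B (a \<cdot> Tar C f) (b \<cdot> Tar C f)"
    using P assms B
    by (subst fplus_cmp) (simp_all add: cmp_eq_extend[OF P(4)] cmp_eq_extend[OF P(5)])
  moreover have "fplus C B (T2fst C A \<cdot> Tar C f) (T2snd C A \<cdot> Tar C f) = tsum C A \<cdot> Tar C f"
    using sum_natural[of f A B] f by (simp add: fplus_def)
  ultimately show ?thesis
    using P assms by (simp add: fplus_def)
qed

text \<open>The sum of the additive bundle \<open>T p\<close>, that is, the second addition on \<open>T\<^sup>2 A\<close>; it is defined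
  for vectors with the same image under \<open>T p\<close>.\<close>

definition tplus :: "'o \<Rightarrow> 'm \<Rightarrow> 'm \<Rightarrow> 'm" where
  "tplus A a b = pair C (Tar C (T2fst C A)) (Tar C (T2snd C A)) a b \<cdot> Tar C (tsum C A)"

text \<open>The two additions on the double tangent bundle are conjugate under the flip, so every law for
  \<open>tplus\<close> is inherited from the sum of \<open>p\<close>.\<close>

lemma tplus_flip:
  assumes "A \<in> Obj C" "a \<in> Arr C" "b \<in> Arr C"
    and "tgt C a = Tob C (Tob C A)" "tgt C b = Tob C (Tob C A)"
    and "src C a = src C b" and "a \<cdot> Tar C (tproj C A) = b \<cdot> Tar C (tproj C A)"
  shows "tplus A a b = fplus C (Tob C A) (a \<cdot> tflip C A) (b \<cdot> tflip C A) \<cdot> tflip C A"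
proof -
  note P = pair_eqs[OF T2_is_pullback(2)[OF assms(1)], of a b]
  have eq: "Tar C (T2fst C A) \<cdot> Tar C (tproj C A) = Tar C (T2snd C A) \<cdot> Tar C (tproj C A)"
    using is_pullbackD(10)[OF T2_is_pullback(2)[OF assms(1)]] .
  have "Tar C (tsum C A) \<cdot> tflip C A
      = fplus C (Tob C A) (Tar C (T2fst C A) \<cdot> tflip C A) (Tar C (T2snd C A) \<cdot> tflip C A)"
    using flip_additive[OF assms(1)]
    by (auto simp: additive_bundle_morphism_def Tproj_bundle_def proj_bundle_def fplus_def)
  then have "(tplus A a b \<cdot> tflip C A)
    = fplus C (Tob C A) (a \<cdot> tflip C A) (b \<cdot> tflip C A)"
    using P assms eq
    by (simp add: tplus_def fplus_cmp cmp_eq_extend[OF P(4)] cmp_eq_extend[OF P(5)])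
  then have "(tplus A a b \<cdot> tflip C A) \<cdot> tflip C A
    = fplus C (Tob C A) (a \<cdot> tflip C A) (b \<cdot> tflip C A) \<cdot> tflip C A"
    by simp
  then show ?thesis
    using P assms by (simp add: tplus_def)
qed

lemma tplus_typing [simp]:
  assumes "A \<in> Obj C" "a \<in> Arr C" "b \<in> Arr C"
    and "tgt C a = Tob C (Tob C A)" "tgt C b = Tob C (Tob C A)"
    and "src C a = src C b" and "a \<cdot> Tar C (tproj C A) = b \<cdot> Tar C (tproj C A)"
  shows "tplus A a b \<in> Arr C" "src C (tplus A a b) = src C b"
    "tgt C (tplus A a b) = Tob C (Tob C A)"
    "tplus A a b \<cdot> Tar C (tproj C A) = b \<cdot> Tar C (tproj C A)"
  using assms by (simp_all add: tplus_flip)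

lemma Tar_fplus:
  assumes "A \<in> Obj C" "a \<in> Arr C" "b \<in> Arr C" "tgt C a = Tob C A" "tgt C b = Tob C A"
    and "src C a = src C b" and "a \<cdot> tproj C A = b \<cdot> tproj C A"
  shows "Tar C (fplus C A a b) = tplus A (Tar C a) (Tar C b)"
proof -
  note P = pair_eqs[OF T2_is_pullback(1)[OF assms(1)], of a b]
  have e: "Tar C a \<cdot> Tar C (tproj C A) = Tar C b \<cdot> Tar C (tproj C A)"
    using assms by (simp flip: Tar_cmp)
  note Q = pair_eqs[OF T2_is_pullback(2)[OF assms(1)], of "Tar C a" "Tar C b"]
  have "Tar C (pair C (T2fst C A) (T2snd C A) a b)
      = pair C (Tar C (T2fst C A)) (Tar C (T2snd C A)) (Tar C a) (Tar C b)"
    by (rule pullback_jointly_monic[OF T2_is_pullback(2)[OF assms(1)]])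
      (use P Q e assms in \<open>simp_all flip: Tar_cmp\<close>)
  then show ?thesis
    using P assms by (simp add: fplus_def tplus_def)
qed

text \<open>This is naturality of the sum of \<open>p\<close> along the map \<open>s : T\<^sub>2 A \<rightarrow> T A\<close>: the two pairs are tangent
  vectors of \<open>T\<^sub>2 A\<close>, which are added componentwise.\<close>

lemma interchange:
  assumes A: "A \<in> Obj C" and Arr: "a \<in> Arr C" "b \<in> Arr C" "a' \<in> Arr C" "b' \<in> Arr C"
    and tgt: "tgt C a = Tob C (Tob C A)" "tgt C b = Tob C (Tob C A)"
     "tgt C a' = Tob C (Tob C A)" "tgt C b' = Tob C (Tob C A)"
    and src: "src C b = src C a" "src C a' = src C a" "src C b' = src C a"
    and Tp: "a \<cdot> Tar C (tproj C A) = b \<cdot> Tar C (tproj C A)"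
      "a' \<cdot> Tar C (tproj C A) = b' \<cdot> Tar C (tproj C A)"
    and p: "a \<cdot> tproj C (Tob C A) = a' \<cdot> tproj C (Tob C A)"
      "b \<cdot> tproj C (Tob C A) = b' \<cdot> tproj C (Tob C A)"
  shows "fplus C (Tob C A) (tplus A a b) (tplus A a' b')
    = tplus A (fplus C (Tob C A) a a') (fplus C (Tob C A) b b')"
proof -
  let ?pair = "pair C (Tar C (T2fst C A)) (Tar C (T2snd C A))"
  note pb = T2_is_pullback[OF A]
  note P = pair_eqs[OF pb(2), of a b] and P' = pair_eqs[OF pb(2), of a' b']
  note Q = pair_eqs[OF pb(2), of "fplus C (Tob C A) a a'" "fplus C (Tob C A) b b'"]
  have T2: "T2 C A \<in> Obj C" using A by simp
  have h: "?pair a b \<cdot> tproj C (T2 C A) = ?pair a' b' \<cdot> tproj C (T2 C A)"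
  proof (rule pullback_jointly_monic[OF pb(1)])
    have "?pair a b \<cdot> (Tar C (T2fst C A) \<cdot> tproj C (Tob C A))
        = ?pair a' b' \<cdot> (Tar C (T2fst C A) \<cdot> tproj C (Tob C A))"
      using P P' assms
      by (simp add: cmp_eq_extend[OF P(4)] cmp_eq_extend[OF P'(4)] del: proj_nat)
    then show "(?pair a b \<cdot> tproj C (T2 C A)) \<cdot> T2fst C A
        = (?pair a' b' \<cdot> tproj C (T2 C A)) \<cdot> T2fst C A"
      using P P' assms by simp
    have "?pair a b \<cdot> (Tar C (T2snd C A) \<cdot> tproj C (Tob C A))
        = ?pair a' b' \<cdot> (Tar C (T2snd C A) \<cdot> tproj C (Tob C A))"
      using P P' assms
      by (simp add: cmp_eq_extend[OF P(5)] cmp_eq_extend[OF P'(5)] del: proj_nat)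
    then show "(?pair a b \<cdot> tproj C (T2 C A)) \<cdot> T2snd C A
        = (?pair a' b' \<cdot> tproj C (T2 C A)) \<cdot> T2snd C A"
      using P P' assms by simp
  qed (use P P' assms in simp_all)
  have sum_Tp: "fplus C (Tob C A) a a' \<cdot> Tar C (tproj C A)
      = fplus C (Tob C A) b b' \<cdot> Tar C (tproj C A)"
    using assms by (simp add: fplus_Tar)
  have "fplus C (T2 C A) (?pair a b) (?pair a' b')
    = ?pair (fplus C (Tob C A) a a') (fplus C (Tob C A) b b')"
    by (rule pullback_jointly_monic[OF pb(2)])
      (use P P' Q h sum_Tp T2 assms in \<open>simp_all add: fplus_Tar\<close>)
  then show ?thesis
    using fplus_Tar[OF T2, of "?pair a b" "?pair a' b'" "tsum C A" "Tob C A"] P P' h T2 A Arr tgt src Tp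
    by (simp add: tplus_def)
qed


text \<open>Naturality of the zero, oriented so that applications of \<open>T\<close> disappear.\<close>

lemma zero_slide [simp]:
  assumes "f \<in> Arr C" "src C f = A"
  shows "tzero C A \<cdot> Tar C f = f \<cdot> tzero C (tgt C f)"
  using zero_nat[of f] assms by simp

lemmas zero_slide_extend [simp] = cmp_eq_extend[OF zero_slide]

lemma fplus_flip:
  assumes "A \<in> Obj C" "a \<in> Arr C" "b \<in> Arr C"
    and "tgt C a = Tob C (Tob C A)" "tgt C b = Tob C (Tob C A)"
    and "src C a = src C b" and "a \<cdot> tproj C (Tob C A) = b \<cdot> tproj C (Tob C A)"
  shows "fplus C (Tob C A) a b \<cdot> tflip C A = tplus A (a \<cdot> tflip C A) (b \<cdot> tflip C A)"
  using assms by (simp add: tplus_flip)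

lemma tplus_proj [simp]:
  assumes "A \<in> Obj C" "a \<in> Arr C" "b \<in> Arr C"
    and "tgt C a = Tob C (Tob C A)" "tgt C b = Tob C (Tob C A)"
    and "src C a = src C b" and "a \<cdot> Tar C (tproj C A) = b \<cdot> Tar C (tproj C A)"
  shows "tplus A a b \<cdot> tproj C (Tob C A)
    = fplus C A (a \<cdot> tproj C (Tob C A)) (b \<cdot> tproj C (Tob C A))"
  using assms by (simp add: tplus_flip fplus_Tar)

lemma tplus_cmp:
  assumes "A \<in> Obj C" "a \<in> Arr C" "b \<in> Arr C"
    and "tgt C a = Tob C (Tob C A)" "tgt C b = Tob C (Tob C A)"
    and "src C a = src C b" and "a \<cdot> Tar C (tproj C A) = b \<cdot> Tar C (tproj C A)"
    and h: "h \<in> Arr C" "tgt C h = src C a"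
  shows "h \<cdot> tplus A a b = tplus A (h \<cdot> a) (h \<cdot> b)"
proof -
  have "h \<cdot> tplus A a b = (h \<cdot> fplus C (Tob C A) (a \<cdot> tflip C A) (b \<cdot> tflip C A)) \<cdot> tflip C A"
    using assms by (simp add: tplus_flip)
  also have "\<dots> = tplus A (h \<cdot> a) (h \<cdot> b)"
    using assms by (simp add: tplus_flip fplus_cmp)
  finally show ?thesis .
qed

lemma tplus_Tar_Tar:
  assumes "A \<in> Obj C" "a \<in> Arr C" "b \<in> Arr C"
    and "tgt C a = Tob C (Tob C A)" "tgt C b = Tob C (Tob C A)"
    and "src C a = src C b" and "a \<cdot> Tar C (tproj C A) = b \<cdot> Tar C (tproj C A)"
    and f: "f \<in> Arr C" "src C f = A" "tgt C f = B"
  shows "tplus A a b \<cdot> Tar C (Tar C f) = tplus B (a \<cdot> Tar C (Tar C f)) (b \<cdot> Tar C (Tar C f))"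
proof -
  have B: "B \<in> Obj C" using f by auto
  have e: "a \<cdot> (Tar C (Tar C f) \<cdot> Tar C (tproj C B)) = b \<cdot> (Tar C (Tar C f) \<cdot> Tar C (tproj C B))"
    using assms B by (simp flip: Tar_cmp) (simp flip: assoc)
  have "tplus A a b \<cdot> Tar C (Tar C f)
      = fplus C (Tob C A) (a \<cdot> tflip C A) (b \<cdot> tflip C A) \<cdot> (tflip C A \<cdot> Tar C (Tar C f))"
    using assms by (simp add: tplus_flip)
  also have "\<dots> = (fplus C (Tob C A) (a \<cdot> tflip C A) (b \<cdot> tflip C A) \<cdot> Tar C (Tar C f)) \<cdot> tflip C B"
    using assms B by (simp add: flip_nat)
  also have "\<dots> = fplus C (Tob C B) (a \<cdot> (tflip C A \<cdot> Tar C (Tar C f)))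
       (b \<cdot> (tflip C A \<cdot> Tar C (Tar C f))) \<cdot> tflip C B"
    using assms B by (simp add: fplus_Tar)
  also have "tflip C A \<cdot> Tar C (Tar C f) = Tar C (Tar C f) \<cdot> tflip C B"
    using flip_nat[of f B] f by simp
  finally show ?thesis
    using assms B e by (simp add: tplus_flip)
qed

lemma tplus_zero_left:
  assumes "A \<in> Obj C" "a \<in> Arr C" "tgt C a = Tob C (Tob C A)"
  shows "tplus A (a \<cdot> (Tar C (tproj C A) \<cdot> Tar C (tzero C A))) a = a"
  using fplus_zero_left[of "Tob C A" "a \<cdot> tflip C A"] assms
  by (simp add: tplus_flip)

lemma tplus_assoc:
  assumes "A \<in> Obj C" "a \<in> Arr C" "b \<in> Arr C" "c \<in> Arr C"
    and "tgt C a = Tob C (Tob C A)" "tgt C b = Tob C (Tob C A)" "tgt C c = Tob C (Tob C A)"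
    and "src C a = src C b" "src C b = src C c"
    and "a \<cdot> Tar C (tproj C A) = b \<cdot> Tar C (tproj C A)"
      "b \<cdot> Tar C (tproj C A) = c \<cdot> Tar C (tproj C A)"
  shows "tplus A (tplus A a b) c = tplus A a (tplus A b c)"
  using assms by (simp add: tplus_flip fplus_assoc)

lemma tplus_commute:
  assumes "A \<in> Obj C" "a \<in> Arr C" "b \<in> Arr C"
    and "tgt C a = Tob C (Tob C A)" "tgt C b = Tob C (Tob C A)"
    and "src C a = src C b" and "a \<cdot> Tar C (tproj C A) = b \<cdot> Tar C (tproj C A)"
  shows "tplus A a b = tplus A b a"
  using fplus_commute[of "Tob C A" "a \<cdot> tflip C A" "b \<cdot> tflip C A"] assms
  by (simp add: tplus_flip)

lemma tplus_swap:
  assumes "A \<in> Obj C" "a \<in> Arr C" "b \<in> Arr C" "c \<in> Arr C" "d \<in> Arr C"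
    and "tgt C a = Tob C (Tob C A)" "tgt C b = Tob C (Tob C A)"
      "tgt C c = Tob C (Tob C A)" "tgt C d = Tob C (Tob C A)"
    and "src C a = src C d" "src C b = src C d" "src C c = src C d"
    and "a \<cdot> Tar C (tproj C A) = d \<cdot> Tar C (tproj C A)"
      "b \<cdot> Tar C (tproj C A) = d \<cdot> Tar C (tproj C A)"
      "c \<cdot> Tar C (tproj C A) = d \<cdot> Tar C (tproj C A)"
  shows "tplus A (tplus A a b) (tplus A c d) = tplus A (tplus A a c) (tplus A b d)"
proof -
  have "tplus A b (tplus A c d) = tplus A (tplus A b c) d"
    using assms by (simp add: tplus_assoc)
  also have "\<dots> = tplus A (tplus A c b) d"
    using assms tplus_commute[of A b c] by simp
  also have "\<dots> = tplus A c (tplus A b d)"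
    using assms by (simp add: tplus_assoc)
  finally show ?thesis
    using assms by (simp add: tplus_assoc)
qed

text \<open>The lift is additive from \<open>p\<close> to \<open>T p\<close>; as it is invariant under the flip, it is additive for
  both additions.\<close>

lemma lift_fplus:
  assumes "A \<in> Obj C" "a \<in> Arr C" "b \<in> Arr C" "tgt C a = Tob C A" "tgt C b = Tob C A"
    and "src C a = src C b" and "a \<cdot> tproj C A = b \<cdot> tproj C A"
  shows "fplus C A a b \<cdot> tlift C A = tplus A (a \<cdot> tlift C A) (b \<cdot> tlift C A)"
    and "fplus C A a b \<cdot> tlift C A = fplus C (Tob C A) (a \<cdot> tlift C A) (b \<cdot> tlift C A)"
proof -
  note P = pair_eqs[OF T2_is_pullback(1)[OF assms(1)], of a b]
  have eq: "T2fst C A \<cdot> tproj C A = T2snd C A \<cdot> tproj C A"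
    using is_pullbackD(10)[OF T2_is_pullback(1)[OF assms(1)]] .
  have eq': "T2fst C A \<cdot> (tproj C A \<cdot> tzero C A) = T2snd C A \<cdot> (tproj C A \<cdot> tzero C A)"
    using assms(1) eq by (simp flip: assoc)
  have e: "a \<cdot> (tproj C A \<cdot> tzero C A) = b \<cdot> (tproj C A \<cdot> tzero C A)"
    using assms by (simp flip: assoc)
  have "tsum C A \<cdot> tlift C A = tplus A (T2fst C A \<cdot> tlift C A) (T2snd C A \<cdot> tlift C A)"
    using lift_additive[OF assms(1)]
    by (auto simp: additive_bundle_morphism_def Tproj_bundle_def proj_bundle_def tplus_def)
  then show 1: "fplus C A a b \<cdot> tlift C A = tplus A (a \<cdot> tlift C A) (b \<cdot> tlift C A)"
    using P assms eq'
    by (simp add: fplus_def tplus_cmp cmp_eq_extend[OF P(4)] cmp_eq_extend[OF P(5)])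
  have "fplus C A a b \<cdot> (tlift C A \<cdot> tflip C A)
    = (fplus C A a b \<cdot> tlift C A) \<cdot> tflip C A"
    using assms by (simp del: lift_flip_lift)
  also have "\<dots> = fplus C (Tob C A) (a \<cdot> tlift C A) (b \<cdot> tlift C A)"
    unfolding 1 using assms e by (simp add: tplus_flip)
  finally show "fplus C A a b \<cdot> tlift C A = fplus C (Tob C A) (a \<cdot> tlift C A) (b \<cdot> tlift C A)"
    using assms by simp
qed

lemma fplus_zero_map:
  assumes "A \<in> Obj C" "a \<in> Arr C" "b \<in> Arr C" "tgt C a = Tob C A" "tgt C b = Tob C A"
    and "src C a = src C b" and "a \<cdot> tproj C A = b \<cdot> tproj C A"
  shows "fplus C A a b \<cdot> tzero C (Tob C A) = tplus A (a \<cdot> tzero C (Tob C A)) (b \<cdot> tzero C (Tob C A))"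
proof -
  have e: "Tar C a \<cdot> Tar C (tproj C A) = Tar C b \<cdot> Tar C (tproj C A)"
    using assms by (simp flip: Tar_cmp)
  have "fplus C A a b \<cdot> tzero C (Tob C A) = tzero C (src C b) \<cdot> tplus A (Tar C a) (Tar C b)"
    using assms by (simp flip: Tar_fplus)
  also have "\<dots> = tplus A (tzero C (src C b) \<cdot> Tar C a) (tzero C (src C b) \<cdot> Tar C b)"
    using assms e by - (rule tplus_cmp, simp_all)
  finally show ?thesis using assms by simp
qed

lemma xi_cmp:
  assumes "A \<in> Obj C" "h \<in> Arr C" "tgt C h = T2 C A"
  shows "h \<cdot> xi C A
    = tplus A (h \<cdot> (T2fst C A \<cdot> tlift C A)) (h \<cdot> (T2snd C A \<cdot> tzero C (Tob C A)))"
proof -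
  have eq: "T2fst C A \<cdot> tproj C A = T2snd C A \<cdot> tproj C A"
    using is_pullbackD(10)[OF T2_is_pullback(1)[OF assms(1)]] .
  have eq': "T2fst C A \<cdot> (tproj C A \<cdot> tzero C A) = T2snd C A \<cdot> (tproj C A \<cdot> tzero C A)"
    using assms(1) eq by (simp flip: assoc)
  have "xi C A = tplus A (T2fst C A \<cdot> tlift C A) (T2snd C A \<cdot> tzero C (Tob C A))"
    by (simp add: xi_def tplus_def)
  then show ?thesis
    using assms eq' by (simp add: tplus_cmp)
qed

lemma zero_monic:
  assumes "A \<in> Obj C" "a \<in> Arr C" "b \<in> Arr C" "tgt C a = A" "tgt C b = A"
    and "a \<cdot> tzero C A = b \<cdot> tzero C A"
  shows "a = b"
proof -
  have "(a \<cdot> tzero C A) \<cdot> tproj C A = (b \<cdot> tzero C A) \<cdot> tproj C A"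
    using assms(6) by simp
  then show ?thesis using assms(1-5) by simp
qed

lemma xi_typing [simp]:
  assumes "A \<in> Obj C"
  shows "xi C A \<in> Arr C" "src C (xi C A) = T2 C A" "tgt C (xi C A) = Tob C (Tob C A)"
    "xi C A \<cdot> Tar C (tproj C A) = T2fst C A \<cdot> (tproj C A \<cdot> tzero C A)"
  using is_pullbackD[OF tangent_pullback_pullback(1)[OF lift_universal[OF assms]]] assms
  by simp_all

text \<open>The second leg of the universal square is recovered from the first, since the zero section is
  monic; so \<open>\<xi>\<close> alone is monic and the pairing in the definition of \<open>{f}\<close> is unique.\<close>

lemma xi_monic:
  assumes A: "A \<in> Obj C" and h: "h \<in> Arr C" "tgt C h = T2 C A"
    and h': "h' \<in> Arr C" "tgt C h' = T2 C A"
    and eq: "h \<cdot> xi C A = h' \<cdot> xi C A"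
  shows "h = h'"
proof (rule pullback_jointly_monic[OF tangent_pullback_pullback(1)[OF lift_universal[OF A]] h h' eq])
  have "(h \<cdot> xi C A) \<cdot> Tar C (tproj C A) = (h' \<cdot> xi C A) \<cdot> Tar C (tproj C A)"
    using eq by simp
  then have "(h \<cdot> (T2fst C A \<cdot> tproj C A)) \<cdot> tzero C A = (h' \<cdot> (T2fst C A \<cdot> tproj C A)) \<cdot> tzero C A"
    using A h h' by simp
  then show "h \<cdot> (T2fst C A \<cdot> tproj C A) = h' \<cdot> (T2fst C A \<cdot> tproj C A)"
    using A h h' by - (rule zero_monic[of A], simp_all)
qed

lemma xi_pair:
  assumes "A \<in> Obj C" "g \<in> Arr C" "y \<in> Arr C" "tgt C g = Tob C A" "tgt C y = Tob C A"
    and "src C g = src C y" and "g \<cdot> tproj C A = y \<cdot> tproj C A"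
  shows "pair C (T2fst C A) (T2snd C A) g y \<cdot> xi C A
    = tplus A (g \<cdot> tlift C A) (y \<cdot> tzero C (Tob C A))"
proof -
  note P = pair_eqs[OF T2_is_pullback(1)[OF assms(1)], of g y]
  show ?thesis
    using P assms by (simp add: xi_cmp cmp_eq_extend[OF P(4)] cmp_eq_extend[OF P(5)])
qed

lemma lift_decomposition_unique:
  assumes A: "A \<in> Obj C"
    and g: "g \<in> Arr C" "tgt C g = Tob C A" and y: "y \<in> Arr C" "tgt C y = Tob C A"
    and g': "g' \<in> Arr C" "tgt C g' = Tob C A" and y': "y' \<in> Arr C" "tgt C y' = Tob C A"
    and "src C g = src C y" "src C g' = src C y'"
    and "g \<cdot> tproj C A = y \<cdot> tproj C A" "g' \<cdot> tproj C A = y' \<cdot> tproj C A"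
    and "tplus A (g \<cdot> tlift C A) (y \<cdot> tzero C (Tob C A))
      = tplus A (g' \<cdot> tlift C A) (y' \<cdot> tzero C (Tob C A))"
  shows "g = g'"
proof -
  note P = pair_eqs[OF T2_is_pullback(1)[OF A], of g y]
  note P' = pair_eqs[OF T2_is_pullback(1)[OF A], of g' y']
  have "pair C (T2fst C A) (T2snd C A) g y = pair C (T2fst C A) (T2snd C A) g' y'"
    using P P' assms by - (rule xi_monic[of A], simp_all add: xi_pair)
  then show ?thesis
    using P(4) P'(4) assms by simp
qed

text \<open>The hypothesis says that \<open>f\<close> is a cone over the universal square. The second component of the
  induced map into \<open>T\<^sub>2 A\<close> must be \<open>f \<cdot> p\<close>, as the lift summand projects to zero.\<close>

lemma lift_decomposition_exists:
  assumes A: "A \<in> Obj C" and f: "f \<in> Arr C" "tgt C f = Tob C (Tob C A)"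
    and vert: "f \<cdot> Tar C (tproj C A) = f \<cdot> (tproj C (Tob C A) \<cdot> (tproj C A \<cdot> tzero C A))"
  obtains g where "g \<in> Arr C" "src C g = src C f" "tgt C g = Tob C A"
    "g \<cdot> tproj C A = f \<cdot> (tproj C (Tob C A) \<cdot> tproj C A)"
    "f = tplus A (g \<cdot> tlift C A) (f \<cdot> (tproj C (Tob C A) \<cdot> tzero C (Tob C A)))"
proof -
  let ?y = "f \<cdot> (tproj C (Tob C A) \<cdot> tproj C A)"
  note pb = tangent_pullback_pullback(1)[OF lift_universal[OF A]]
  have eq: "T2fst C A \<cdot> tproj C A = T2snd C A \<cdot> tproj C A"
    using is_pullbackD(10)[OF T2_is_pullback(1)[OF A]] .
  define h where "h = pair C (xi C A) (T2fst C A \<cdot> tproj C A) f ?y"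
  have h: "h \<in> Arr C" "src C h = src C f" "tgt C h = T2 C A"
    "h \<cdot> xi C A = f" "h \<cdot> (T2fst C A \<cdot> tproj C A) = ?y"
    using pair_eqs[OF pb, of f ?y] A f vert by (simp_all add: h_def)
  have "h \<cdot> (T2fst C A \<cdot> (tproj C A \<cdot> tzero C A)) = (h \<cdot> (T2fst C A \<cdot> tproj C A)) \<cdot> tzero C A"
    using A h(1-3) by simp
  also have "\<dots> = (h \<cdot> (T2snd C A \<cdot> tproj C A)) \<cdot> tzero C A"
    by (simp add: eq)
  also have "\<dots> = h \<cdot> (T2snd C A \<cdot> (tproj C A \<cdot> tzero C A))"
    using A h(1-3) by simp
  finally have e: "h \<cdot> (T2fst C A \<cdot> (tproj C A \<cdot> tzero C A))
    = h \<cdot> (T2snd C A \<cdot> (tproj C A \<cdot> tzero C A))" .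
  have f_eq: "f = tplus A (h \<cdot> (T2fst C A \<cdot> tlift C A)) (h \<cdot> (T2snd C A \<cdot> tzero C (Tob C A)))"
    using xi_cmp[OF A h(1,3)] h(4) by simp
  have "f \<cdot> tproj C (Tob C A)
      = fplus C A (h \<cdot> (T2fst C A \<cdot> (tproj C A \<cdot> tzero C A))) (h \<cdot> T2snd C A)"
    by (subst f_eq) (use A h e in \<open>simp add: tplus_proj\<close>)
  also have "\<dots> = h \<cdot> T2snd C A"
    unfolding e using fplus_zero_left[of A "h \<cdot> T2snd C A"] A h by simp
  finally have y: "h \<cdot> T2snd C A = f \<cdot> tproj C (Tob C A)" ..
  have "f = tplus A ((h \<cdot> T2fst C A) \<cdot> tlift C A) ((h \<cdot> T2snd C A) \<cdot> tzero C (Tob C A))"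
    using f_eq A h by simp
  then have "f = tplus A ((h \<cdot> T2fst C A) \<cdot> tlift C A) (f \<cdot> (tproj C (Tob C A) \<cdot> tzero C (Tob C A)))"
    unfolding y using A f by simp
  then show thesis
    using A h by (intro that[of "h \<cdot> T2fst C A"]) simp_all
qed

text \<open>A lifted vector \<open>g \<cdot> l\<close> is its own decomposition, with second component the zero vector.\<close>

lemma lift_monic:
  assumes A: "A \<in> Obj C" and g: "g \<in> Arr C" "tgt C g = Tob C A"
    and g': "g' \<in> Arr C" "tgt C g' = Tob C A"
    and eq: "g \<cdot> tlift C A = g' \<cdot> tlift C A"
  shows "g = g'"
proof -
  have src: "src C g = src C g'"
    using eq cmp_typing(2)[of g "tlift C A"] cmp_typing(2)[of g' "tlift C A"] A g g' by simp
  have "(g \<cdot> tlift C A) \<cdot> tproj C (Tob C A) = (g' \<cdot> tlift C A) \<cdot> tproj C (Tob C A)"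
    using eq by simp
  then have "(g \<cdot> tproj C A) \<cdot> tzero C A = (g' \<cdot> tproj C A) \<cdot> tzero C A"
    using A g g' by simp
  then have p: "g \<cdot> tproj C A = g' \<cdot> tproj C A"
    using A g g' by - (rule zero_monic[of A], simp_all)
  have "g \<cdot> (tproj C A \<cdot> (tzero C A \<cdot> tzero C (Tob C A)))
      = (g \<cdot> tproj C A) \<cdot> (tzero C A \<cdot> tzero C (Tob C A))"
    using A g by simp
  also have "\<dots> = g' \<cdot> (tproj C A \<cdot> (tzero C A \<cdot> tzero C (Tob C A)))"
    unfolding p using A g' by simp
  finally have z: "g \<cdot> (tproj C A \<cdot> (tzero C A \<cdot> tzero C (Tob C A)))
      = g' \<cdot> (tproj C A \<cdot> (tzero C A \<cdot> tzero C (Tob C A)))" .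
  show ?thesis
    using A g g' src p z eq
    by - (rule lift_decomposition_unique[of A g "g \<cdot> (tproj C A \<cdot> tzero C A)" g'
          "g' \<cdot> (tproj C A \<cdot> tzero C A)"], simp_all)
qed

end


section \<open>Negatives and the vertical part of double tangent vectors\<close>

context tangent_category_with_negatives
begin

lemma neg_typing [simp]:
  assumes "A \<in> Obj C"
  shows "tneg C A \<in> Arr C" "src C (tneg C A) = Tob C A" "tgt C (tneg C A) = Tob C A"
    "tneg C A \<cdot> tproj C A = tproj C A"
  using neg_Hom[OF assms] neg_proj[OF assms] by auto

lemmas neg_typing_extend [simp] = cmp_eq_extend[OF neg_typing(4)]

lemma neg_nat:
  assumes "f \<in> Arr C" "tgt C f = B"
  shows "Tar C f \<cdot> tneg C B = tneg C (src C f) \<cdot> Tar C f"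
  using neg_natural[of f "src C f" B] assms by auto

lemma fplus_neg_left:
  assumes A: "A \<in> Obj C" and a: "a \<in> Arr C" "tgt C a = Tob C A"
  shows "fplus C A (a \<cdot> tneg C A) a = a \<cdot> (tproj C A \<cdot> tzero C A)"
proof -
  have "a \<cdot> fplus C A (tneg C A) (idm C (Tob C A)) = fplus C A (a \<cdot> tneg C A) a"
    using A a by (subst fplus_cmp) simp_all
  moreover have "fplus C A (tneg C A) (idm C (Tob C A)) = tproj C A \<cdot> tzero C A"
    using neg_sum[OF A] by (simp add: fplus_def)
  ultimately show ?thesis by simp
qed

text \<open>Generalized elements of \<open>T A\<close> over a fixed map \<open>f\<close> into \<open>A\<close>. For \<open>f = id\<close> these are the vector
  fields; the general case also covers families of double tangent vectors.\<close>

definition lifts :: "'o \<Rightarrow> 'm \<Rightarrow> 'm monoid" where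
  "lifts A f = \<lparr>carrier = {a \<in> Hom C (src C f) (Tob C A). a \<cdot> tproj C A = f},
     monoid.mult = fplus C A, one = f \<cdot> tzero C A\<rparr>"

lemma in_lifts [simp]:
  "a \<in> carrier (lifts A f)
    \<longleftrightarrow> a \<in> Arr C \<and> src C a = src C f \<and> tgt C a = Tob C A \<and> a \<cdot> tproj C A = f"
  by (auto simp: lifts_def)

lemma lifts_mult [simp]: "monoid.mult (lifts A f) = fplus C A"
  and lifts_one [simp]: "one (lifts A f) = f \<cdot> tzero C A"
  by (simp_all add: lifts_def)

lemma lifts_comm_group:
  assumes f: "f \<in> Arr C" "tgt C f = A"
  shows "comm_group (lifts A f)"
proof (rule comm_groupI)
  have A: "A \<in> Obj C" using f by auto
  have zero: "f \<cdot> tzero C A = a \<cdot> (tproj C A \<cdot> tzero C A)" if "a \<in> carrier (lifts A f)" for a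
    using that A f by (auto simp flip: assoc)
  show "\<one>\<^bsub>lifts A f\<^esub> \<in> carrier (lifts A f)"
    using A f by simp
  fix a assume a: "a \<in> carrier (lifts A f)"
  show "\<one>\<^bsub>lifts A f\<^esub> \<otimes>\<^bsub>lifts A f\<^esub> a = a"
    using zero[OF a] fplus_zero_left[of A a] A a by simp
  show "\<exists>b\<in>carrier (lifts A f). b \<otimes>\<^bsub>lifts A f\<^esub> a = \<one>\<^bsub>lifts A f\<^esub>"
    using fplus_neg_left[of A a] zero[OF a] A a by (intro bexI[of _ "a \<cdot> tneg C A"]) simp_all
  fix b assume b: "b \<in> carrier (lifts A f)"
  show "a \<otimes>\<^bsub>lifts A f\<^esub> b \<in> carrier (lifts A f)"
    using A a b by simp
  show "a \<otimes>\<^bsub>lifts A f\<^esub> b = b \<otimes>\<^bsub>lifts A f\<^esub> a"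
    using A a b by (simp add: fplus_commute[of A a b])
  fix c assume c: "c \<in> carrier (lifts A f)"
  show "a \<otimes>\<^bsub>lifts A f\<^esub> b \<otimes>\<^bsub>lifts A f\<^esub> c = a \<otimes>\<^bsub>lifts A f\<^esub> (b \<otimes>\<^bsub>lifts A f\<^esub> c)"
    using A a b c by (simp add: fplus_assoc)
qed

lemma lifts_inv:
  assumes f: "f \<in> Arr C" "tgt C f = A" and a: "a \<in> carrier (lifts A f)"
  shows "inv\<^bsub>lifts A f\<^esub> a = a \<cdot> tneg C A"
proof -
  interpret comm_group "lifts A f" by (rule lifts_comm_group[OF f])
  have A: "A \<in> Obj C" using f by auto
  have "f \<cdot> tzero C A = a \<cdot> (tproj C A \<cdot> tzero C A)"
    using a A f by (auto simp flip: assoc)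
  then show ?thesis
    using fplus_neg_left[of A a] a A by (intro inv_equality) simp_all
qed

lemma fplus_right_cancel:
  assumes "A \<in> Obj C" "a \<in> Arr C" "b \<in> Arr C" "c \<in> Arr C"
    and "tgt C a = Tob C A" "tgt C b = Tob C A" "tgt C c = Tob C A"
    and "src C a = src C c" "src C b = src C c"
    and "a \<cdot> tproj C A = c \<cdot> tproj C A" "b \<cdot> tproj C A = c \<cdot> tproj C A"
    and "fplus C A a c = fplus C A b c"
  shows "a = b"
proof -
  interpret comm_group "lifts A (c \<cdot> tproj C A)" by (rule lifts_comm_group) (use assms in auto)
  show ?thesis
    using right_cancel[of c a b] assms by simp
qed

lemma fplus_minus_cancel:
  assumes "A \<in> Obj C" "a \<in> Arr C" "b \<in> Arr C"
    and "tgt C a = Tob C A" "tgt C b = Tob C A"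
    and "src C a = src C b" and "a \<cdot> tproj C A = b \<cdot> tproj C A"
  shows "fplus C A (fplus C A a (b \<cdot> tneg C A)) b = a"
proof -
  have "b \<cdot> (tproj C A \<cdot> tzero C A) = a \<cdot> (tproj C A \<cdot> tzero C A)"
    using assms by (simp flip: assoc)
  then show ?thesis
    using assms fplus_zero_right[of A a] by (simp add: fplus_assoc fplus_neg_left)
qed

text \<open>Together with \<open>brace_props\<close>, this replaces the description of \<open>{f}\<close> by \<open>\<xi>\<close> with one by the
  second addition: \<open>{f}\<close> is the lift part of \<open>f\<close>.\<close>

lemma brace_tplus_lift:
  assumes A: "A \<in> Obj C" and g: "g \<in> Arr C" "tgt C g = Tob C A"
    and y: "y \<in> Arr C" "tgt C y = Tob C A"
    and s: "src C g = src C y" and p: "g \<cdot> tproj C A = y \<cdot> tproj C A"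
  shows "brace C A (tplus A (g \<cdot> tlift C A) (y \<cdot> tzero C (Tob C A))) = g"
proof -
  note P = pair_eqs[OF T2_is_pullback(1)[OF A], of g y]
  have e: "g \<cdot> (tproj C A \<cdot> tzero C A) = y \<cdot> (tproj C A \<cdot> tzero C A)"
    using A g y p by (simp flip: assoc)
  let ?h = "pair C (T2fst C A) (T2snd C A) g y"
  let ?f = "tplus A (g \<cdot> tlift C A) (y \<cdot> tzero C (Tob C A))"
  have h: "?h \<in> Hom C (src C ?f) (T2 C A)" "?h \<cdot> xi C A = ?f"
    using A g y s p e P by (simp_all add: xi_pair)
  have "(THE h. h \<in> Hom C (src C ?f) (T2 C A) \<and> h \<cdot> xi C A = ?f) = ?h"
    using h xi_monic[OF A] by (intro the_equality) auto
  then show ?thesis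
    using A g y s p P by (simp add: brace_def)
qed

text \<open>The condition under which \<open>{f}\<close> is defined.\<close>

definition vertical :: "'o \<Rightarrow> 'm \<Rightarrow> bool" where
  "vertical A f \<longleftrightarrow> f \<in> Arr C \<and> tgt C f = Tob C (Tob C A) \<and>
     f \<cdot> Tar C (tproj C A) = f \<cdot> (tproj C (Tob C A) \<cdot> (tproj C A \<cdot> tzero C A))"

lemma verticalD:
  assumes "vertical A f"
  shows "f \<in> Arr C" "tgt C f = Tob C (Tob C A)"
    "f \<cdot> Tar C (tproj C A) = f \<cdot> (tproj C (Tob C A) \<cdot> (tproj C A \<cdot> tzero C A))"
  using assms by (simp_all add: vertical_def)

lemma brace_props:
  assumes A: "A \<in> Obj C" and f: "vertical A f"
  shows "brace C A f \<in> Arr C" "src C (brace C A f) = src C f" "tgt C (brace C A f) = Tob C A"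
    "brace C A f \<cdot> tproj C A = f \<cdot> (tproj C (Tob C A) \<cdot> tproj C A)"
    "f = tplus A (brace C A f \<cdot> tlift C A) (f \<cdot> (tproj C (Tob C A) \<cdot> tzero C (Tob C A)))"
proof -
  obtain g where g: "g \<in> Arr C" "src C g = src C f" "tgt C g = Tob C A"
    "g \<cdot> tproj C A = f \<cdot> (tproj C (Tob C A) \<cdot> tproj C A)"
    and eq: "f = tplus A (g \<cdot> tlift C A) (f \<cdot> (tproj C (Tob C A) \<cdot> tzero C (Tob C A)))"
    using lift_decomposition_exists[OF A] f unfolding vertical_def by metis
  have fA: "f \<in> Arr C" "tgt C f = Tob C (Tob C A)"
    using f by (auto simp: vertical_def)
  have "brace C A (tplus A (g \<cdot> tlift C A) ((f \<cdot> tproj C (Tob C A)) \<cdot> tzero C (Tob C A))) = g"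
    using A fA g by (intro brace_tplus_lift) simp_all
  then have "brace C A (tplus A (g \<cdot> tlift C A) (f \<cdot> (tproj C (Tob C A) \<cdot> tzero C (Tob C A)))) = g"
    using A fA by simp
  then have "brace C A f = g"
    by (simp flip: eq)
  then show "brace C A f \<in> Arr C" "src C (brace C A f) = src C f" "tgt C (brace C A f) = Tob C A"
    "brace C A f \<cdot> tproj C A = f \<cdot> (tproj C (Tob C A) \<cdot> tproj C A)"
    "f = tplus A (brace C A f \<cdot> tlift C A) (f \<cdot> (tproj C (Tob C A) \<cdot> tzero C (Tob C A)))"
    using g eq by auto
qed


text \<open>Add the decompositions of \<open>f\<close> and \<open>f'\<close> termwise; the lift and the zero section are additive for
  \<open>tplus\<close>.\<close>

lemma brace_tplus:
  assumes A: "A \<in> Obj C" and f: "vertical A f" and f': "vertical A f'"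
    and s: "src C f = src C f'"
    and p: "f \<cdot> (tproj C (Tob C A) \<cdot> tproj C A) = f' \<cdot> (tproj C (Tob C A) \<cdot> tproj C A)"
  shows "brace C A (tplus A f f') = fplus C A (brace C A f) (brace C A f')"
proof -
  note [simp] = verticalD(1,2)[OF f] verticalD(1,2)[OF f']
  let ?g = "brace C A f" and ?g' = "brace C A f'"
  let ?y = "f \<cdot> tproj C (Tob C A)" and ?y' = "f' \<cdot> tproj C (Tob C A)"
  note g = brace_props[OF A f] and g' = brace_props[OF A f']
  have pz: "f \<cdot> (tproj C (Tob C A) \<cdot> (tproj C A \<cdot> h)) = f' \<cdot> (tproj C (Tob C A) \<cdot> (tproj C A \<cdot> h))"
    if "h \<in> Arr C" "src C h = A" for h
  proof -
    have "(f \<cdot> (tproj C (Tob C A) \<cdot> tproj C A)) \<cdot> h = (f' \<cdot> (tproj C (Tob C A) \<cdot> tproj C A)) \<cdot> h"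
      by (simp add: p)
    then show ?thesis using A that by simp
  qed
  note gz = cmp_eq_extend[OF g(4)] cmp_eq_extend[OF g'(4)]
  have "tplus A f f' = tplus A (tplus A (?g \<cdot> tlift C A) (?y \<cdot> tzero C (Tob C A)))
      (tplus A (?g' \<cdot> tlift C A) (?y' \<cdot> tzero C (Tob C A)))"
    using g(5) g'(5) A by simp
  also have "\<dots> = tplus A (tplus A (?g \<cdot> tlift C A) (?g' \<cdot> tlift C A))
      (tplus A (?y \<cdot> tzero C (Tob C A)) (?y' \<cdot> tzero C (Tob C A)))"
    using A g(1-4) g'(1-4) s p pz by (intro tplus_swap) (simp_all add: gz)
  also have "\<dots> = tplus A (fplus C A ?g ?g' \<cdot> tlift C A) (fplus C A ?y ?y' \<cdot> tzero C (Tob C A))"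
    using A g(1-4) g'(1-4) s p by (simp add: lift_fplus(1) fplus_zero_map)
  finally show ?thesis
    using A g(1-4) g'(1-4) s p by (simp add: brace_tplus_lift)
qed

text \<open>Naturality of the lift and the zero carries the decomposition of \<open>f\<close> along \<open>T\<^sup>2 k\<close>.\<close>

lemma brace_Tar_Tar:
  assumes A: "A \<in> Obj C" and f: "vertical A f" and k: "k \<in> Arr C" "src C k = A" "tgt C k = B"
  shows "brace C B (f \<cdot> Tar C (Tar C k)) = brace C A f \<cdot> Tar C k"
proof -
  note [simp] = verticalD(1,2)[OF f]
  let ?g = "brace C A f" and ?y = "f \<cdot> tproj C (Tob C A)"
  note g = brace_props[OF A f]
  have B: "B \<in> Obj C" using k by auto
  note gz = cmp_eq_extend[OF g(4)]
  have f_eq: "f = tplus A (?g \<cdot> tlift C A) (?y \<cdot> tzero C (Tob C A))"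
    using g(5) A by simp
  have "tplus A (?g \<cdot> tlift C A) (?y \<cdot> tzero C (Tob C A)) \<cdot> Tar C (Tar C k)
      = tplus B ((?g \<cdot> Tar C k) \<cdot> tlift C B) ((?y \<cdot> Tar C k) \<cdot> tzero C (Tob C B))"
    using A B g(1-4) k by (subst tplus_Tar_Tar) (simp_all add: lift_nat gz)
  then have "f \<cdot> Tar C (Tar C k)
      = tplus B ((?g \<cdot> Tar C k) \<cdot> tlift C B) ((?y \<cdot> Tar C k) \<cdot> tzero C (Tob C B))"
    using f_eq by simp
  moreover have "brace C B (tplus B ((?g \<cdot> Tar C k) \<cdot> tlift C B) ((?y \<cdot> Tar C k) \<cdot> tzero C (Tob C B)))
      = ?g \<cdot> Tar C k"
    using A B g(1-4) k by (intro brace_tplus_lift) (simp_all add: gz)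
  ultimately show ?thesis by simp
qed


lemma fplus_neg_right:
  assumes A: "A \<in> Obj C" and a: "a \<in> Arr C" "tgt C a = Tob C A"
  shows "fplus C A a (a \<cdot> tneg C A) = a \<cdot> (tproj C A \<cdot> tzero C A)"
  using fplus_neg_left[OF assms] fplus_commute[of A a "a \<cdot> tneg C A"] assms by simp

lemma vertical_difference:
  assumes A: "A \<in> Obj C" and a: "a \<in> Arr C" "tgt C a = Tob C (Tob C A)"
    and b: "b \<in> Arr C" "tgt C b = Tob C (Tob C A)" and s: "src C a = src C b"
    and p: "a \<cdot> tproj C (Tob C A) = b \<cdot> tproj C (Tob C A)"
    and Tp: "a \<cdot> Tar C (tproj C A) = b \<cdot> Tar C (tproj C A)"
  shows "vertical A (fplus C (Tob C A) a (b \<cdot> tneg C (Tob C A)))"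
proof -
  have "fplus C (Tob C A) a (b \<cdot> tneg C (Tob C A)) \<cdot> Tar C (tproj C A)
      = fplus C A (b \<cdot> Tar C (tproj C A)) ((b \<cdot> Tar C (tproj C A)) \<cdot> tneg C A)"
    using assms by (simp add: fplus_Tar neg_nat)
  also have "\<dots> = b \<cdot> (tproj C (Tob C A) \<cdot> (tproj C A \<cdot> tzero C A))"
    using A b by (subst fplus_neg_right) simp_all
  also have "\<dots> = (b \<cdot> tproj C (Tob C A)) \<cdot> (tproj C A \<cdot> tzero C A)"
    using A b by simp
  also have "b \<cdot> tproj C (Tob C A)
      = fplus C (Tob C A) a (b \<cdot> tneg C (Tob C A)) \<cdot> tproj C (Tob C A)"
    using assms by simp
  also have "\<dots> \<cdot> (tproj C A \<cdot> tzero C A) =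
      fplus C (Tob C A) a (b \<cdot> tneg C (Tob C A)) \<cdot> (tproj C (Tob C A) \<cdot> (tproj C A \<cdot> tzero C A))"
    using A a b s p by (subst assoc) simp_all
  finally show ?thesis
    using assms by (simp add: vertical_def)
qed

text \<open>Solved for \<open>a\<close>, the decomposition of \<open>a - b\<close> says that \<open>a\<close> arises from \<open>b\<close> by adding a lifted
  vector.\<close>

lemma difference_decomposition:
  assumes A: "A \<in> Obj C" and a: "a \<in> Arr C" "tgt C a = Tob C (Tob C A)"
    and b: "b \<in> Arr C" "tgt C b = Tob C (Tob C A)" and s: "src C a = src C b"
    and p: "a \<cdot> tproj C (Tob C A) = b \<cdot> tproj C (Tob C A)"
    and Tp: "a \<cdot> Tar C (tproj C A) = b \<cdot> Tar C (tproj C A)"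
  defines "g \<equiv> brace C A (fplus C (Tob C A) a (b \<cdot> tneg C (Tob C A)))"
  shows "g \<in> Arr C" "src C g = src C b" "tgt C g = Tob C A"
    "g \<cdot> tproj C A = b \<cdot> (tproj C (Tob C A) \<cdot> tproj C A)"
    "a = fplus C (Tob C A)
      (tplus A (g \<cdot> tlift C A) (b \<cdot> (tproj C (Tob C A) \<cdot> tzero C (Tob C A)))) b"
proof -
  let ?f = "fplus C (Tob C A) a (b \<cdot> tneg C (Tob C A))"
  note g = brace_props[OF A vertical_difference[OF assms(1-8)], folded g_def]
  have f: "?f \<in> Arr C" "src C ?f = src C b" "tgt C ?f = Tob C (Tob C A)"
    "?f \<cdot> tproj C (Tob C A) = b \<cdot> tproj C (Tob C A)"
    using assms by simp_all
  note e = cmp_eq_extend[OF f(4)]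
  show "g \<in> Arr C" "src C g = src C b" "tgt C g = Tob C A"
    "g \<cdot> tproj C A = b \<cdot> (tproj C (Tob C A) \<cdot> tproj C A)"
    using g(1-4) A b f by (simp_all add: e)
  have "?f = tplus A (g \<cdot> tlift C A) (b \<cdot> (tproj C (Tob C A) \<cdot> tzero C (Tob C A)))"
    using g(5) A b f by (simp add: e)
  then show "a = fplus C (Tob C A)
      (tplus A (g \<cdot> tlift C A) (b \<cdot> (tproj C (Tob C A) \<cdot> tzero C (Tob C A)))) b"
    using fplus_minus_cancel[of "Tob C A" a b] assms by simp
qed

lemma tplus_right_cancel:
  assumes "A \<in> Obj C" "a \<in> Arr C" "b \<in> Arr C" "c \<in> Arr C"
    and "tgt C a = Tob C (Tob C A)" "tgt C b = Tob C (Tob C A)" "tgt C c = Tob C (Tob C A)"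
    and "src C a = src C c" "src C b = src C c"
    and "a \<cdot> Tar C (tproj C A) = c \<cdot> Tar C (tproj C A)"
      "b \<cdot> Tar C (tproj C A) = c \<cdot> Tar C (tproj C A)"
    and "tplus A a c = tplus A b c"
  shows "a = b"
proof -
  have "tplus A a c \<cdot> tflip C A = tplus A b c \<cdot> tflip C A"
    using assms(12) by simp
  then have "fplus C (Tob C A) (a \<cdot> tflip C A) (c \<cdot> tflip C A)
      = fplus C (Tob C A) (b \<cdot> tflip C A) (c \<cdot> tflip C A)"
    using assms(1-11) by (simp add: tplus_flip)
  then have "a \<cdot> tflip C A = b \<cdot> tflip C A"
    using assms(1-11) by - (rule fplus_right_cancel[of "Tob C A" _ _ "c \<cdot> tflip C A"], simp_all)
  then have "(a \<cdot> tflip C A) \<cdot> tflip C A = (b \<cdot> tflip C A) \<cdot> tflip C A"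
    by simp
  then show ?thesis using assms(1-11) by simp
qed

text \<open>The antisymmetry of the bracket, for arbitrary double tangent vectors \<open>a\<close>, \<open>b\<close> with the same
  projections. By \<open>difference_decomposition\<close> and the interchange law, \<open>a\<close> is the \<open>tplus\<close>-sum of
  \<open>u = g \<cdot> l + w\<close> and \<open>b\<close>, with \<open>w\<close> the zero of the second addition. The same lemma, for the flipped
  vectors and flipped back, makes \<open>b\<close> the \<open>tplus\<close>-sum of \<open>u' = g' \<cdot> l + w\<close> and \<open>a\<close>. So the
  \<open>tplus\<close>-sum of \<open>u\<close> and \<open>u'\<close> is \<open>w\<close>, whence \<open>(g + g') \<cdot> l\<close> is zero; and the lift is monic.\<close>

lemma brace_difference_flip:
  assumes A: "A \<in> Obj C" and a: "a \<in> Arr C" "tgt C a = Tob C (Tob C A)"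
    and b: "b \<in> Arr C" "tgt C b = Tob C (Tob C A)" and s: "src C a = src C b"
    and p: "a \<cdot> tproj C (Tob C A) = b \<cdot> tproj C (Tob C A)"
    and Tp: "a \<cdot> Tar C (tproj C A) = b \<cdot> Tar C (tproj C A)"
  defines "g \<equiv> brace C A (fplus C (Tob C A) a (b \<cdot> tneg C (Tob C A)))"
    and "g' \<equiv> brace C A (fplus C (Tob C A) (b \<cdot> tflip C A) ((a \<cdot> tflip C A) \<cdot> tneg C (Tob C A)))"
  shows "fplus C A g g' = b \<cdot> (tproj C (Tob C A) \<cdot> (tproj C A \<cdot> tzero C A))"
proof -
  have A': "Tob C A \<in> Obj C" using A by simp
  let ?p = "tproj C A" and ?pT = "tproj C (Tob C A)" and ?l = "tlift C A" and ?c = "tflip C A"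
  let ?bpp = "b \<cdot> (?pT \<cdot> ?p)"
  note D = difference_decomposition[OF assms(1-8), folded g_def]
  have bc: "b \<cdot> ?c \<in> Arr C" "tgt C (b \<cdot> ?c) = Tob C (Tob C A)"
    "a \<cdot> ?c \<in> Arr C" "tgt C (a \<cdot> ?c) = Tob C (Tob C A)" "src C (b \<cdot> ?c) = src C (a \<cdot> ?c)"
    "(b \<cdot> ?c) \<cdot> ?pT = (a \<cdot> ?c) \<cdot> ?pT" "(b \<cdot> ?c) \<cdot> Tar C ?p = (a \<cdot> ?c) \<cdot> Tar C ?p"
    using A a b s p Tp by simp_all
  note D' = difference_decomposition[OF A bc, folded g'_def]
  have app: "a \<cdot> (?pT \<cdot> ?p) = ?bpp"
    using A a b by (simp add: cmp_eq_extend[OF p])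
  have g': "g' \<in> Arr C" "src C g' = src C b" "tgt C g' = Tob C A" "g' \<cdot> ?p = ?bpp"
    using D'(1-4) app A a b s by simp_all
  note g = D(1-4)
  note ex = cmp_eq_extend[OF g(4)] cmp_eq_extend[OF g'(4)]
  define w where "w = b \<cdot> (Tar C ?p \<cdot> Tar C (tzero C A))"
  have w: "w \<in> Arr C" "src C w = src C b" "tgt C w = Tob C (Tob C A)" "w \<cdot> Tar C ?p = b \<cdot> Tar C ?p"
    "w \<cdot> ?pT = ?bpp \<cdot> tzero C A" "w \<cdot> ?c = b \<cdot> (Tar C ?p \<cdot> tzero C (Tob C A))"
    using A b by (simp_all add: w_def)
  define u where "u = fplus C (Tob C A) (g \<cdot> ?l) w"
  define u' where "u' = fplus C (Tob C A) (g' \<cdot> ?l) w"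
  have b_zero: "fplus C A (b \<cdot> (?pT \<cdot> (?p \<cdot> tzero C A))) (b \<cdot> Tar C ?p) = b \<cdot> Tar C ?p"
    using fplus_zero_left[of A "b \<cdot> Tar C ?p"] A b by simp
  have u: "u \<in> Arr C" "src C u = src C b" "tgt C u = Tob C (Tob C A)" "u \<cdot> Tar C ?p = b \<cdot> Tar C ?p"
    unfolding u_def using A b g w b_zero by (simp_all add: ex fplus_Tar)
  have u': "u' \<in> Arr C" "src C u' = src C b" "tgt C u' = Tob C (Tob C A)"
    "u' \<cdot> Tar C ?p = b \<cdot> Tar C ?p"
    unfolding u'_def using A b g' w b_zero by (simp_all add: ex fplus_Tar)
  have wb: "tplus A w b = b"
    using tplus_zero_left[of A b] A b by (simp add: w_def)
  have "w = a \<cdot> (Tar C ?p \<cdot> Tar C (tzero C A))"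
    using A a b by (simp add: w_def cmp_eq_extend[OF Tp])
  then have wa: "tplus A w a = a"
    using tplus_zero_left[of A a] A a by simp
  \<comment> \<open>Writing \<open>b\<close> as \<open>w\<close> plus \<open>b\<close> for the second addition makes the interchange law applicable.\<close>
  have "a = fplus C (Tob C A) (tplus A (g \<cdot> ?l) (b \<cdot> (?pT \<cdot> tzero C (Tob C A)))) (tplus A w b)"
    using D(5) wb by simp
  also have "\<dots> = tplus A u (fplus C (Tob C A) (b \<cdot> (?pT \<cdot> tzero C (Tob C A))) b)"
    unfolding u_def using A b g w by (subst interchange) (simp_all add: ex)
  also have "\<dots> = tplus A u b"
    using fplus_zero_left[of "Tob C A" b] A b by simp
  finally have a_eq: "a = tplus A u b" .
  have "(b \<cdot> ?c) \<cdot> ?c = fplus C (Tob C A)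
      (tplus A (g' \<cdot> ?l) ((a \<cdot> ?c) \<cdot> (?pT \<cdot> tzero C (Tob C A)))) (a \<cdot> ?c) \<cdot> ?c"
    by (subst D'(5)[symmetric]) (rule refl)
  also have "\<dots> = tplus A (tplus A (g' \<cdot> ?l) (a \<cdot> (Tar C ?p \<cdot> tzero C (Tob C A))) \<cdot> ?c) a"
    using A a b s g' b_zero Tp
    by (subst fplus_flip) (simp_all add: ex app cmp_eq_extend[OF p])
  also have "tplus A (g' \<cdot> ?l) (a \<cdot> (Tar C ?p \<cdot> tzero C (Tob C A))) \<cdot> ?c = u'"
    using A a b s g' by (simp add: tplus_flip u'_def w_def ex cmp_eq_extend[OF Tp])
  finally have b_eq: "b = tplus A u' a"
    using A b by simp
  have "tplus A (tplus A u u') a = tplus A u (tplus A u' a)"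
    using A a u u' Tp s by (simp add: tplus_assoc)
  also have "\<dots> = tplus A w a"
    using a_eq b_eq wa by metis
  finally have "tplus A (tplus A u u') a = tplus A w a" .
  then have "tplus A u u' = w"
    using A a s w u u' Tp by - (rule tplus_right_cancel[of A _ _ a], simp_all)
  moreover have "tplus A u u' = fplus C (Tob C A) (tplus A (g \<cdot> ?l) (g' \<cdot> ?l)) (tplus A w w)"
    unfolding u_def u'_def using A b g g' w by (subst interchange) (simp_all add: ex)
  moreover have "tplus A w w = w"
    using tplus_zero_left[of A w] A b w by (simp add: w_def)
  moreover have "tplus A (g \<cdot> ?l) (g' \<cdot> ?l) = fplus C A g g' \<cdot> ?l"
    using A g g' by (simp add: lift_fplus(1))
  ultimately have "fplus C (Tob C A) (fplus C A g g' \<cdot> ?l) w = w"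
    by simp
  also have "\<dots> = fplus C (Tob C A) (w \<cdot> (?pT \<cdot> tzero C (Tob C A))) w"
    using fplus_zero_left[of "Tob C A" w] A w by simp
  finally have sum: "fplus C (Tob C A) (fplus C A g g' \<cdot> ?l) w
    = fplus C (Tob C A) (w \<cdot> (?pT \<cdot> tzero C (Tob C A))) w" .
  have "fplus C A g g' \<cdot> ?p = ?bpp"
    using A b g g' by simp
  then have "fplus C A g g' \<cdot> ?l = w \<cdot> (?pT \<cdot> tzero C (Tob C A))"
    using A b g g' w sum
    by - (rule fplus_right_cancel[of "Tob C A" _ _ w], simp_all add: cmp_eq_extend[of _ ?p ?bpp])
  also have "\<dots> = (b \<cdot> (?pT \<cdot> (?p \<cdot> tzero C A))) \<cdot> ?l"
    using A b by (simp add: w_def zero_lift)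
  finally show ?thesis
    using A b g g' by - (rule lift_monic[of A], simp_all)
qed


section \<open>The Lie bracket of vector fields\<close>

lemma VF_iff:
  "X \<in> VF C E \<longleftrightarrow>
    X \<in> Arr C \<and> src C X = E \<and> tgt C X = Tob C E \<and> X \<cdot> tproj C E = idm C E"
  by (auto simp: VF_def)

lemma VF_base: "X \<in> VF C E \<Longrightarrow> E \<in> Obj C"
  by (auto simp: VF_iff)

lemma VF_cmp: "X \<in> VF C E \<Longrightarrow> h \<in> Arr C \<Longrightarrow> src C h = E \<Longrightarrow> X \<cdot> (tproj C E \<cdot> h) = h"
  using cmp_eq_extend[of X "tproj C E" "idm C E" h] VF_base[of X E] by (simp add: VF_iff)

lemma VF_group_lifts: "E \<in> Obj C \<Longrightarrow> VF_group C E = lifts E (idm C E)"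
  by (simp add: VF_group_def lifts_def VF_def)

text \<open>Negation is natural along \<open>s : T\<^sub>2 A \<rightarrow> T A\<close>.\<close>

lemma tplus_neg:
  assumes A: "A \<in> Obj C" and a: "a \<in> Arr C" "tgt C a = Tob C (Tob C A)"
    and b: "b \<in> Arr C" "tgt C b = Tob C (Tob C A)" and s: "src C a = src C b"
    and Tp: "a \<cdot> Tar C (tproj C A) = b \<cdot> Tar C (tproj C A)"
  shows "tplus A a b \<cdot> tneg C (Tob C A)
    = tplus A (a \<cdot> tneg C (Tob C A)) (b \<cdot> tneg C (Tob C A))"
proof -
  note pb = T2_is_pullback(2)[OF A]
  have e: "(a \<cdot> tneg C (Tob C A)) \<cdot> Tar C (tproj C A) = (b \<cdot> tneg C (Tob C A)) \<cdot> Tar C (tproj C A)"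
    using cmp_eq_extend[OF Tp, of "tneg C A"] A a b
    by (simp add: neg_nat)
  let ?pair = "pair C (Tar C (T2fst C A)) (Tar C (T2snd C A))"
  note P = pair_eqs[OF pb, of a b]
    pair_eqs[OF pb, of "a \<cdot> tneg C (Tob C A)" "b \<cdot> tneg C (Tob C A)"]
  note ex = cmp_eq_extend[OF P(4)] cmp_eq_extend[OF P(5)]
  have nat: "Tar C k \<cdot> tneg C (Tob C A) = tneg C (T2 C A) \<cdot> Tar C k"
    if "k \<in> Arr C" "src C k = T2 C A" "tgt C k = Tob C A" for k
    using neg_nat[of k "Tob C A"] that by simp
  have "?pair a b \<cdot> tneg C (T2 C A) = ?pair (a \<cdot> tneg C (Tob C A)) (b \<cdot> tneg C (Tob C A))"
    by (rule pullback_jointly_monic[OF pb])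
      (use A a b s Tp e P in \<open>simp_all add: nat[symmetric] ex\<close>)
  moreover have "tplus A a b \<cdot> tneg C (Tob C A)
      = (?pair a b \<cdot> tneg C (T2 C A)) \<cdot> Tar C (tsum C A)"
    using A a b s Tp P(1-5) by (simp add: tplus_def nat)
  ultimately show ?thesis
    by (simp add: tplus_def)
qed

text \<open>The two double tangent vectors whose difference defines \<open>[X, Y]\<close> have the same projections: \<open>Y\<close>
  under \<open>p\<close> and \<open>X\<close> under \<open>T p\<close>. For \<open>[Y, X]\<close> their roles are exchanged by the flip.\<close>

lemma bracket_args:
  assumes X: "X \<in> VF C E" and Y: "Y \<in> VF C E"
  defines "a \<equiv> X \<cdot> Tar C Y" and "b \<equiv> Y \<cdot> (Tar C X \<cdot> tflip C E)"
  shows "E \<in> Obj C" "a \<in> Arr C" "tgt C a = Tob C (Tob C E)" "b \<in> Arr C" "tgt C b = Tob C (Tob C E)"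
    "src C a = E" "src C b = E"
    "a \<cdot> tproj C (Tob C E) = Y" "b \<cdot> tproj C (Tob C E) = Y"
    "a \<cdot> Tar C (tproj C E) = X" "b \<cdot> Tar C (tproj C E) = X"
    "lie C E X Y = brace C E (fplus C (Tob C E) a (b \<cdot> tneg C (Tob C E)))"
proof -
  show E: "E \<in> Obj C" using X by (rule VF_base)
  have T: "Tar C Z \<cdot> Tar C (tproj C E) = idm C (Tob C E)" if "Z \<in> VF C E" for Z
    using that E Tar_cmp[of Z "tproj C E"] by (simp add: VF_iff)
  show "a \<in> Arr C" "tgt C a = Tob C (Tob C E)" "b \<in> Arr C" "tgt C b = Tob C (Tob C E)"
    "src C a = E" "src C b = E"
    "a \<cdot> tproj C (Tob C E) = Y" "b \<cdot> tproj C (Tob C E) = Y"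
    "a \<cdot> Tar C (tproj C E) = X" "b \<cdot> Tar C (tproj C E) = X"
    "lie C E X Y = brace C E (fplus C (Tob C E) a (b \<cdot> tneg C (Tob C E)))"
    using X Y E T[OF X] T[OF Y]
    by (simp_all add: a_def b_def lie_def VF_iff VF_cmp[OF X] VF_cmp[OF Y])
qed

lemma lie_VF:
  assumes X: "X \<in> VF C E" and Y: "Y \<in> VF C E"
  shows "lie C E X Y \<in> VF C E"
proof -
  note B = bracket_args[OF X Y]
  note D = difference_decomposition[of E "X \<cdot> Tar C Y" "Y \<cdot> (Tar C X \<cdot> tflip C E)"]
  show ?thesis
    using D(1-4) B Y by (simp add: VF_iff flip: assoc)
qed

lemma lie_antisym:
  assumes X: "X \<in> VF C E" and Y: "Y \<in> VF C E"
  shows "fplus C E (lie C E X Y) (lie C E Y X) = tzero C E"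
proof -
  note B = bracket_args[OF X Y] and B' = bracket_args[OF Y X]
  have "(Y \<cdot> (Tar C X \<cdot> tflip C E)) \<cdot> tflip C E = Y \<cdot> Tar C X"
    "(X \<cdot> Tar C Y) \<cdot> tflip C E = X \<cdot> (Tar C Y \<cdot> tflip C E)"
    using X Y B(1) by (simp_all add: VF_iff)
  moreover have "(Y \<cdot> (Tar C X \<cdot> tflip C E)) \<cdot> (tproj C (Tob C E) \<cdot> (tproj C E \<cdot> tzero C E)) = tzero C E"
    using cmp_eq_extend[OF B(9), of "tproj C E \<cdot> tzero C E"] B(1,4,5) VF_cmp[OF Y, of "tzero C E"]
    by (simp del: assoc)
  ultimately show ?thesis
    using brace_difference_flip[of E "X \<cdot> Tar C Y" "Y \<cdot> (Tar C X \<cdot> tflip C E)"] B B'(12)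
    by simp
qed

lemma fplus_VF: "X \<in> VF C E \<Longrightarrow> Y \<in> VF C E \<Longrightarrow> fplus C E X Y \<in> VF C E"
  using VF_base[of X E] by (simp add: VF_iff)

text \<open>Both \<open>X \<cdot> T Y\<close> and \<open>Y \<cdot> T X \<cdot> c\<close> send sums in \<open>Y\<close> to \<open>tplus\<close>-sums, the first because \<open>T\<close> is applied
  to the sum, the second because of the flip. The interchange law then splits the difference.\<close>

lemma lie_add_right:
  assumes X: "X \<in> VF C E" and Y: "Y \<in> VF C E" and Y': "Y' \<in> VF C E"
  shows "lie C E X (fplus C E Y Y') = fplus C E (lie C E X Y) (lie C E X Y')"
proof -
  define a where "a = X \<cdot> Tar C Y"
  define a' where "a' = X \<cdot> Tar C Y'"
  define b where "b = Y \<cdot> (Tar C X \<cdot> tflip C E)"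
  define b' where "b' = Y' \<cdot> (Tar C X \<cdot> tflip C E)"
  note B = bracket_args[OF X Y, folded a_def b_def]
  note B' = bracket_args[OF X Y', folded a'_def b'_def]
  note E = B(1)
  let ?n = "tneg C (Tob C E)"
  have T: "Tar C Z \<cdot> Tar C (tproj C E) = idm C (Tob C E)" if "Z \<in> VF C E" for Z
    using that E Tar_cmp[of Z "tproj C E"] by (simp add: VF_iff)
  have 1: "X \<cdot> Tar C (fplus C E Y Y') = tplus E a a'"
    using X Y Y' E T[OF Y] T[OF Y']
    by (simp add: a_def a'_def VF_iff Tar_fplus tplus_cmp)
  have "fplus C E Y Y' \<cdot> Tar C X = fplus C (Tob C E) (Y \<cdot> Tar C X) (Y' \<cdot> Tar C X)"
    using X Y Y' E by (intro fplus_Tar) (simp_all add: VF_iff)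
  then have "(fplus C E Y Y' \<cdot> Tar C X) \<cdot> tflip C E = tplus E b b'"
    using X Y Y' E
    by (simp add: fplus_flip b_def b'_def VF_iff VF_cmp[OF Y] VF_cmp[OF Y'])
  then have 2: "(fplus C E Y Y' \<cdot> (Tar C X \<cdot> tflip C E)) \<cdot> ?n = tplus E (b \<cdot> ?n) (b' \<cdot> ?n)"
    using X Y Y' E B B' by (simp add: VF_iff tplus_neg[symmetric])
  have nT: "(k \<cdot> ?n) \<cdot> Tar C (tproj C E) = (k \<cdot> Tar C (tproj C E)) \<cdot> tneg C E"
    if "k \<in> Arr C" "tgt C k = Tob C (Tob C E)" for k
    using that E by (simp add: neg_nat)
  have "lie C E X (fplus C E Y Y')
    = brace C E (fplus C (Tob C E) (tplus E a a') (tplus E (b \<cdot> ?n) (b' \<cdot> ?n)))"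
    using bracket_args(12)[OF X fplus_VF[OF Y Y']] 1 2 by simp
  also have "\<dots> = brace C E (tplus E (fplus C (Tob C E) a (b \<cdot> ?n)) (fplus C (Tob C E) a' (b' \<cdot> ?n)))"
    using B B' E nT[of b] nT[of b'] by (subst interchange) simp_all
  also have "\<dots> = fplus C E (lie C E X Y) (lie C E X Y')"
    unfolding B(12) B'(12)
  proof (rule brace_tplus[OF E])
    show "vertical E (fplus C (Tob C E) a (b \<cdot> ?n))" "vertical E (fplus C (Tob C E) a' (b' \<cdot> ?n))"
      using B B' by (auto intro!: vertical_difference)
    have "fplus C (Tob C E) a (b \<cdot> ?n) \<cdot> tproj C (Tob C E) = Y"
      "fplus C (Tob C E) a' (b' \<cdot> ?n) \<cdot> tproj C (Tob C E) = Y'"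
      using B B' by simp_all
    note e = this[THEN cmp_eq_extend]
    show "fplus C (Tob C E) a (b \<cdot> ?n) \<cdot> (tproj C (Tob C E) \<cdot> tproj C E)
      = fplus C (Tob C E) a' (b' \<cdot> ?n) \<cdot> (tproj C (Tob C E) \<cdot> tproj C E)"
      using B(1-7) B'(1-7) Y Y' e B(8-9) B'(8-9) by (simp add: VF_iff e)
  qed (use B B' in simp)
  finally show ?thesis .
qed

lemma VF_comm_group: "E \<in> Obj C \<Longrightarrow> comm_group (VF_group C E)"
  by (simp add: VF_group_lifts lifts_comm_group)

lemma VF_group_simps [simp]:
  "carrier (VF_group C E) = VF C E" "monoid.mult (VF_group C E) = fplus C E"
  "one (VF_group C E) = tzero C E"
  by (simp_all add: VF_group_def)

lemma VF_group_inv: "X \<in> VF C E \<Longrightarrow> inv\<^bsub>VF_group C E\<^esub> X = X \<cdot> tneg C E"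
  using lifts_inv[of "idm C E" E X] VF_base[of X E]
  by (simp add: VF_group_lifts) (auto simp: VF_iff)

lemma neg_VF: "X \<in> VF C E \<Longrightarrow> X \<cdot> tneg C E \<in> VF C E"
  using VF_base[of X E] by (simp add: VF_iff)

lemma zero_VF: "E \<in> Obj C \<Longrightarrow> tzero C E \<in> VF C E"
  by (simp add: VF_iff)

lemma lie_flip:
  assumes X: "X \<in> VF C E" and Y: "Y \<in> VF C E"
  shows "lie C E X Y = lie C E Y X \<cdot> tneg C E"
proof -
  interpret comm_group "VF_group C E" by (rule VF_comm_group[OF VF_base[OF X]])
  show ?thesis
    using inv_equality[of "lie C E X Y" "lie C E Y X"] lie_antisym[OF X Y] lie_VF[OF X Y] lie_VF[OF Y X]
    by (simp add: VF_group_inv)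
qed

lemma lie_add_left:
  assumes X: "X \<in> VF C E" and X': "X' \<in> VF C E" and Y: "Y \<in> VF C E"
  shows "lie C E (fplus C E X X') Y = fplus C E (lie C E X Y) (lie C E X' Y)"
proof -
  interpret comm_group "VF_group C E" by (rule VF_comm_group[OF VF_base[OF X]])
  have "lie C E (fplus C E X X') Y = inv\<^bsub>VF_group C E\<^esub> (fplus C E (lie C E Y X) (lie C E Y X'))"
    using assms by (simp add: lie_flip[of _ E Y] fplus_VF lie_add_right VF_group_inv lie_VF)
  then show ?thesis
    using inv_mult[of "lie C E Y X" "lie C E Y X'"] assms
    by (simp add: lie_flip[of _ E Y] VF_group_inv lie_VF)
qed


lemma lie_zero:
  assumes X: "X \<in> VF C E"
  shows "lie C E X (tzero C E) = tzero C E"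
proof -
  have E: "E \<in> Obj C" by (rule VF_base[OF X])
  interpret comm_group "VF_group C E" by (rule VF_comm_group[OF E])
  have "fplus C E (lie C E X (tzero C E)) (lie C E X (tzero C E)) = lie C E X (tzero C E)"
    using lie_add_right[OF X zero_VF[OF E] zero_VF[OF E]] l_one[of "tzero C E"] zero_VF[OF E] by simp
  then show ?thesis
    using l_cancel_one'[of "lie C E X (tzero C E)" "lie C E X (tzero C E)"] lie_VF[OF X zero_VF[OF E]]
    by simp
qed

text \<open>By naturality of \<open>{f}\<close> along \<open>q\<close>, the image of \<open>[X, Y]\<close> is the bracket of the zero field with
  itself, pulled back along \<open>q\<close>: both double tangent vectors become the double zero \<open>w\<close>, and so does
  their difference.\<close>

lemma lie_closed_over_zero:
  assumes X: "X \<in> VF C E" and Y: "Y \<in> VF C E"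
    and q: "q \<in> Arr C" "src C q = E" "tgt C q = M"
    and Xq: "X \<cdot> Tar C q = q \<cdot> tzero C M" and Yq: "Y \<cdot> Tar C q = q \<cdot> tzero C M"
  shows "lie C E X Y \<cdot> Tar C q = q \<cdot> tzero C M"
proof -
  have M: "M \<in> Obj C" using q by auto
  define a where "a = X \<cdot> Tar C Y"
  define b where "b = Y \<cdot> (Tar C X \<cdot> tflip C E)"
  note B = bracket_args[OF X Y, folded a_def b_def]
  note E = B(1)
  define w where "w = q \<cdot> (tzero C M \<cdot> tzero C (Tob C M))"
  have w: "w \<in> Arr C" "src C w = E" "tgt C w = Tob C (Tob C M)"
    using q M by (simp_all add: w_def)
  have TX: "Tar C X \<cdot> Tar C (Tar C q) = Tar C q \<cdot> Tar C (tzero C M)"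
    using X q M Xq Tar_cmp[of X "Tar C q"] by (simp add: VF_iff)
  have TY: "Tar C Y \<cdot> Tar C (Tar C q) = Tar C q \<cdot> Tar C (tzero C M)"
    using Y q M Yq Tar_cmp[of Y "Tar C q"] by (simp add: VF_iff)
  have a: "a \<cdot> Tar C (Tar C q) = w"
    using X Y q M E by (simp add: a_def w_def VF_iff TY cmp_eq_extend[OF Xq])
  have fl: "tflip C E \<cdot> Tar C (Tar C q) = Tar C (Tar C q) \<cdot> tflip C M"
    using flip_nat[of q M] q by simp
  have b: "b \<cdot> Tar C (Tar C q) = w"
    using X Y q M E
    by (simp add: b_def w_def VF_iff fl cmp_eq_extend[OF TX] cmp_eq_extend[OF Yq])
  have bn: "(b \<cdot> tneg C (Tob C E)) \<cdot> Tar C (Tar C q) = w \<cdot> tneg C (Tob C M)"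
    using B(2-7) b q M E neg_nat[of "Tar C q" "Tob C M"] by (simp flip: b)
  have "fplus C (Tob C E) a (b \<cdot> tneg C (Tob C E)) \<cdot> Tar C (Tar C q)
      = fplus C (Tob C M) w (w \<cdot> tneg C (Tob C M))"
    using B E q a bn by (subst fplus_Tar[of "Tob C E"]) simp_all
  also have "\<dots> = w"
    using fplus_neg_right[of "Tob C M" w] w q M by (simp add: w_def)
  finally have "lie C E X Y \<cdot> Tar C q = brace C M w"
    unfolding B(12) using B E q
    by (subst brace_Tar_Tar[symmetric, of E _ _ M]) (simp_all add: vertical_difference)
  also have "w = tplus M ((q \<cdot> tzero C M) \<cdot> tlift C M) ((q \<cdot> tzero C M) \<cdot> tzero C (Tob C M))"
    using tplus_zero_left[of M w] w q M by (simp add: w_def zero_lift)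
  also have "brace C M \<dots> = q \<cdot> tzero C M"
    using q M by (intro brace_tplus_lift) simp_all
  finally show ?thesis .
qed

text \<open>A map of tangent bundles that commutes with the lift is additive. After composing with the monic
  lift, the claim becomes naturality of the sum for \<open>T f\<close>, because the lift is additive for the sum
  of \<open>p\<close>.\<close>

lemma linear_additive:
  assumes A: "A \<in> Obj C" and f: "f \<in> Arr C" "src C f = Tob C A" "tgt C f = Tob C B"
    and k: "k \<in> Arr C" "src C k = A" "tgt C k = B"
    and over: "f \<cdot> tproj C B = tproj C A \<cdot> k"
    and linear: "f \<cdot> tlift C B = tlift C A \<cdot> Tar C f"
    and a: "a \<in> Arr C" "tgt C a = Tob C A" and b: "b \<in> Arr C" "tgt C b = Tob C A"
    and s: "src C a = src C b" and p: "a \<cdot> tproj C A = b \<cdot> tproj C A"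
  shows "fplus C A a b \<cdot> f = fplus C B (a \<cdot> f) (b \<cdot> f)"
proof -
  have B: "B \<in> Obj C" using k by auto
  have e: "(a \<cdot> f) \<cdot> tproj C B = (b \<cdot> f) \<cdot> tproj C B"
    using A B a b f k over p by (simp add: cmp_eq_extend[OF p])
  have z: "a \<cdot> (tproj C A \<cdot> h) = b \<cdot> (tproj C A \<cdot> h)" if "h \<in> Arr C" "src C h = A" for h
    using cmp_eq_extend[OF p, of h] A a b that by simp
  have "(fplus C A a b \<cdot> f) \<cdot> tlift C B = (fplus C A a b \<cdot> tlift C A) \<cdot> Tar C f"
    using A B a b s p f by (simp add: linear)
  also have "\<dots> = fplus C (Tob C B) (a \<cdot> (f \<cdot> tlift C B)) (b \<cdot> (f \<cdot> tlift C B))"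
    unfolding linear lift_fplus(2)[OF A a(1) b(1) a(2) b(2) s p]
    using A B a b s f by (subst fplus_Tar) (simp_all add: z)
  also have "\<dots> = fplus C B (a \<cdot> f) (b \<cdot> f) \<cdot> tlift C B"
    using A B a b s f e by (simp add: lift_fplus(2))
  finally show ?thesis
    using A B a b s p f e by - (rule lift_monic[of B], simp_all)
qed

end


text \<open>The cancellation in the structural equation, with \<open>A\<close> for \<open>[\<phi> \<and> id]\<close>, \<open>B\<close> for \<open>[\<phi> \<and> \<psi>]\<^sub>V\<close>, \<open>P\<close> for
  \<open>\<onehalf>[\<phi> \<and> \<phi>]\<close> and \<open>S\<close> for \<open>[X\<^sub>H, Y\<^sub>H]\<^sub>V\<close>; the first two factors are \<open>d\<phi>\<close>.\<close>

lemma (in comm_group) inverse_sum_cancel: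
  assumes [simp]: "A \<in> carrier G" "B \<in> carrier G" "P \<in> carrier G" "S \<in> carrier G"
  shows "A \<otimes> inv (P \<otimes> (B \<otimes> S)) \<otimes> P \<otimes> inv (A \<otimes> inv B) = inv S"
proof -
  have "inv (P \<otimes> (B \<otimes> S)) \<otimes> P = inv (B \<otimes> S) \<otimes> inv P \<otimes> P"
    by (simp add: inv_mult_group)
  also have "\<dots> = inv (B \<otimes> S)"
    by (simp add: m_assoc)
  finally have "A \<otimes> inv (P \<otimes> (B \<otimes> S)) \<otimes> P = A \<otimes> inv (B \<otimes> S)"
    by (simp add: m_assoc)
  also have "\<dots> = inv S \<otimes> (A \<otimes> inv B)"
    by (simp add: inv_mult m_ac)
  finally show ?thesis
    using m_assoc[of "inv S" "A \<otimes> inv B" "inv (A \<otimes> inv B)"] by simp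
qed

section \<open>The structural equation for connection forms\<close>

text \<open>The properties of \<open>\<phi>\<close> and \<open>\<psi>\<close> that the structural equation rests on, stated on \<open>T E\<close> alone:
  the geometry of \<open>q\<close> enters only through the closure of the image of \<open>\<phi>\<close> under the bracket.\<close>

locale connection_forms = tangent_category_with_negatives C
  for C :: "('o, 'm, 'x) tangent_neg_data_scheme" (structure) +
  fixes E :: 'o and \<phi> \<psi> :: 'm
  assumes E: "E \<in> Obj C"
    and \<phi>: "\<phi> \<in> Arr C" "src C \<phi> = Tob C E" "tgt C \<phi> = Tob C E" "\<phi> \<cdot> tproj C E = tproj C E"
    and \<psi>: "\<psi> \<in> Arr C" "src C \<psi> = Tob C E" "tgt C \<psi> = Tob C E" "\<psi> \<cdot> tproj C E = tproj C E"
    and \<phi>_linear: "\<phi> \<cdot> tlift C E = tlift C E \<cdot> Tar C \<phi>"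
    and \<psi>_\<phi>: "\<psi> \<cdot> \<phi> = tproj C E \<cdot> tzero C E"
    and \<phi>_plus_\<psi>: "fplus C E \<phi> \<psi> = idm C (Tob C E)"
    and vertical_closed: "\<And>X Y. X \<in> VF C E \<Longrightarrow> Y \<in> VF C E
      \<Longrightarrow> lie C E (X \<cdot> \<phi>) (Y \<cdot> \<phi>) \<cdot> \<phi> = lie C E (X \<cdot> \<phi>) (Y \<cdot> \<phi>)"
begin

sublocale vf: comm_group "VF_group C E"
  by (rule VF_comm_group[OF E])

lemma \<phi>_VF [simp]: "X \<in> VF C E \<Longrightarrow> X \<cdot> \<phi> \<in> VF C E"
  and \<psi>_VF [simp]: "X \<in> VF C E \<Longrightarrow> X \<cdot> \<psi> \<in> VF C E"
  using E \<phi> \<psi> by (simp_all add: VF_iff)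

lemma lie_in_VF [simp]: "X \<in> VF C E \<Longrightarrow> Y \<in> VF C E \<Longrightarrow> lie C E X Y \<in> VF C E"
  by (rule lie_VF)

lemma neg_in_VF [simp]: "X \<in> VF C E \<Longrightarrow> X \<cdot> tneg C E \<in> VF C E"
  by (rule neg_VF)

lemma fplus_in_VF [simp]: "X \<in> VF C E \<Longrightarrow> Y \<in> VF C E \<Longrightarrow> fplus C E X Y \<in> VF C E"
  by (rule fplus_VF)

lemma zero_in_VF [simp]: "tzero C E \<in> VF C E"
  by (rule zero_VF[OF E])

lemma VF_add_zero [simp]:
  "X \<in> VF C E \<Longrightarrow> fplus C E X (tzero C E) = X" "X \<in> VF C E \<Longrightarrow> fplus C E (tzero C E) X = X"
  using vf.r_one[of X] vf.l_one[of X] by simp_all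

lemma \<phi>_add:
  assumes "X \<in> VF C E" "Y \<in> VF C E"
  shows "fplus C E X Y \<cdot> \<phi> = fplus C E (X \<cdot> \<phi>) (Y \<cdot> \<phi>)"
  using assms E \<phi> \<phi>_linear
  by (intro linear_additive[of E \<phi> E "idm C E"]) (simp_all add: VF_iff)

lemma split_form:
  assumes X: "X \<in> VF C E" shows "fplus C E (X \<cdot> \<phi>) (X \<cdot> \<psi>) = X"
proof -
  have "X \<cdot> fplus C E \<phi> \<psi> = fplus C E (X \<cdot> \<phi>) (X \<cdot> \<psi>)"
    using X E \<phi> \<psi> by (intro fplus_cmp) (simp_all add: VF_iff)
  then show ?thesis
    using X E by (simp add: \<phi>_plus_\<psi> VF_iff)
qed

text \<open>By \<open>split_form\<close>, \<open>\<psi>\<close> is the difference of two additive maps.\<close>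

lemma \<psi>_add:
  assumes X: "X \<in> VF C E" and Y: "Y \<in> VF C E"
  shows "fplus C E X Y \<cdot> \<psi> = fplus C E (X \<cdot> \<psi>) (Y \<cdot> \<psi>)"
proof -
  let ?V = "fplus C E (X \<cdot> \<phi>) (Y \<cdot> \<phi>)"
  have "fplus C E ?V (fplus C E X Y \<cdot> \<psi>) = fplus C E X Y"
    using split_form[of "fplus C E X Y"] X Y by (simp add: \<phi>_add)
  also have "\<dots> = fplus C E (fplus C E (X \<cdot> \<phi>) (X \<cdot> \<psi>)) (fplus C E (Y \<cdot> \<phi>) (Y \<cdot> \<psi>))"
    using X Y by (simp add: split_form)
  also have "\<dots> = fplus C E ?V (fplus C E (X \<cdot> \<psi>) (Y \<cdot> \<psi>))"
    using X Y vf.m_ac by simp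
  finally show ?thesis
    using vf.Units_l_cancel[of ?V "fplus C E X Y \<cdot> \<psi>" "fplus C E (X \<cdot> \<psi>) (Y \<cdot> \<psi>)"] X Y by simp
qed

lemma zero_\<phi> [simp]: "tzero C E \<cdot> \<phi> = tzero C E"
  using vf.l_cancel_one'[of "tzero C E \<cdot> \<phi>" "tzero C E \<cdot> \<phi>"] \<phi>_add[of "tzero C E" "tzero C E"]
    vf.l_one[of "tzero C E"] by simp

lemma horizontal_\<phi> [simp]: "X \<in> VF C E \<Longrightarrow> (X \<cdot> \<psi>) \<cdot> \<phi> = tzero C E"
  using E \<phi> \<psi> \<psi>_\<phi> VF_cmp[of X E "tzero C E"] by (simp add: VF_iff)

lemma neg_\<phi>:
  assumes X: "X \<in> VF C E" shows "(X \<cdot> tneg C E) \<cdot> \<phi> = (X \<cdot> \<phi>) \<cdot> tneg C E"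
proof -
  have "fplus C E ((X \<cdot> tneg C E) \<cdot> \<phi>) (X \<cdot> \<phi>) = tzero C E"
    using X \<phi>_add[of "X \<cdot> tneg C E" X] vf.l_inv[of X] by (simp add: VF_group_inv)
  then show ?thesis
    using vf.inv_equality[of "(X \<cdot> tneg C E) \<cdot> \<phi>" "X \<cdot> \<phi>"] X by (simp add: VF_group_inv)
qed

lemma VFs_1 [simp]: "[X] \<in> VFs C E 1 \<longleftrightarrow> X \<in> VF C E"
  and VFs_2 [simp]: "[X, Y] \<in> VFs C E 2 \<longleftrightarrow> X \<in> VF C E \<and> Y \<in> VF C E"
  by (simp_all add: VFs_def)

lemma VFs_2E:
  assumes "Xs \<in> VFs C E 2"
  obtains X Y where "Xs = [X, Y]" "X \<in> VF C E" "Y \<in> VF C E"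
proof -
  obtain X Y where "Xs = [X, Y]"
    using assms by (auto simp: VFs_def length_Suc_conv numeral_2_eq_2)
  then show thesis
    using assms that by simp
qed

lemma ext_deriv_rank_1:
  assumes X: "X \<in> VF C E" and Y: "Y \<in> VF C E"
    and \<omega>: "\<And>Z. Z \<in> VF C E \<Longrightarrow> \<omega> [Z] \<in> VF C E"
  shows "ext_deriv C E 1 \<omega> [X, Y]
    = fplus C E (fplus C E (lie C E X (\<omega> [Y])) (lie C E Y (\<omega> [X]) \<cdot> tneg C E))
        (\<omega> [lie C E X Y] \<cdot> tneg C E)"
proof -
  let ?f = "\<lambda>k. signed C E ((- 1) ^ k) (lie C E ([X, Y] ! k) (\<omega> (omit k [X, Y])))"
  let ?g = "\<lambda>(i, j). signed C E ((- 1) ^ (i + j))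
    (\<omega> (lie C E ([X, Y] ! i) ([X, Y] ! j) # omit i (omit j [X, Y])))"
  have 0: "?f 0 = lie C E X (\<omega> [Y])" and 1: "?f 1 = lie C E Y (\<omega> [X]) \<cdot> tneg C E"
    by (simp_all add: signed_def omit_def)
  have "finprod (VF_group C E) ?f {0, 1} = fplus C E (?f 0) (?f 1)"
    using X Y \<omega> 0 1 by (subst vf.finprod_insert) (simp_all add: Pi_def)
  moreover have "{..1::nat} = {0, 1}" by auto
  ultimately have f: "finprod (VF_group C E) ?f {..1}
      = fplus C E (lie C E X (\<omega> [Y])) (lie C E Y (\<omega> [X]) \<cdot> tneg C E)"
    using 0 1 by simp
  have 2: "?g (0, 1) = \<omega> [lie C E X Y] \<cdot> tneg C E"
    by (simp add: signed_def omit_def)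
  have "finprod (VF_group C E) ?g {(0, 1)} = ?g (0, 1)"
    using X Y \<omega> 2 by (subst vf.finprod_insert) (simp_all add: Pi_def)
  moreover have "{(i, j). i < j \<and> j \<le> (1::nat)} = {(0, 1)}" by auto
  ultimately have g: "finprod (VF_group C E) ?g {(i, j). i < j \<and> j \<le> 1} = \<omega> [lie C E X Y] \<cdot> tneg C E"
    using 2 by simp
  have "[X, Y] \<in> VFs C E (1 + 1)"
    using X Y by (simp add: VFs_def)
  then show ?thesis
    unfolding ext_deriv_def using f g by simp
qed

lemma permutes_lessThan_2: "\<sigma> permutes {..<2::nat} \<longleftrightarrow> \<sigma> = id \<or> \<sigma> = Transposition.transpose 0 1"
proof -
  have "{..<2::nat} = {0, 1}" by auto
  then show ?thesis by (simp add: permutes_doubleton_iff)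
qed

lemma shuffles_1_1: "shuffles 1 1 = {id, Transposition.transpose 0 1}"
proof -
  have "shuffles 1 1 = {\<sigma>. \<sigma> permutes {..<2::nat}}"
    unfolding shuffles_def one_add_one by (auto simp: strict_mono_on_def)
  then show ?thesis
    unfolding permutes_lessThan_2 by auto
qed

lemma permute_list_2:
  "permute_list id [X, Y] = [X, Y]"
  "permute_list (Transposition.transpose 0 (Suc 0)) [X, Y] = [Y, X]"
  by (simp_all add: permute_list_def upt_rec)

lemma wedge_rank_1_1:
  assumes X: "X \<in> VF C E" and Y: "Y \<in> VF C E"
    and \<omega>: "\<And>Z. Z \<in> VF C E \<Longrightarrow> \<omega> [Z] \<in> VF C E" and \<tau>: "\<And>Z. Z \<in> VF C E \<Longrightarrow> \<tau> [Z] \<in> VF C E"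
  shows "wedge C E 1 1 \<omega> \<tau> [X, Y]
    = fplus C E (lie C E (\<omega> [X]) (\<tau> [Y])) (lie C E (\<omega> [Y]) (\<tau> [X]) \<cdot> tneg C E)"
proof -
  let ?t = "Transposition.transpose 0 1 :: nat \<Rightarrow> nat"
  let ?f = "\<lambda>\<sigma>. signed C E (sign \<sigma>) (lie C E (\<omega> (take 1 (permute_list \<sigma> [X, Y])))
    (\<tau> (drop 1 (permute_list \<sigma> [X, Y]))))"
  have 0: "?f id = lie C E (\<omega> [X]) (\<tau> [Y])"
    and 1: "?f ?t = lie C E (\<omega> [Y]) (\<tau> [X]) \<cdot> tneg C E"
    by (simp_all add: permute_list_2 signed_def sign_swap_id)
  have ne: "id \<noteq> ?t"
    by (metis id_apply transpose_apply_first zero_neq_one)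
  have "finprod (VF_group C E) ?f {id, ?t} = fplus C E (?f id) (?f ?t)"
    using X Y \<omega> \<tau> 0 1 ne by (subst vf.finprod_insert) (simp_all add: Pi_def)
  moreover have "[X, Y] \<in> VFs C E (1 + 1)"
    using X Y by (simp add: VFs_def)
  ultimately show ?thesis
    unfolding wedge_def shuffles_1_1 using 0 1 by simp
qed

lemma map_form_apply [simp]: "X \<in> VF C E \<Longrightarrow> map_form C E f [X] = X \<cdot> f"
  by (simp add: map_form_def flip: One_nat_def)

definition curvature :: "'m list \<Rightarrow> 'm" where
  "curvature = restrict (\<lambda>Xs. ext_deriv C E 1 (map_form C E \<phi>) [Xs ! 0 \<cdot> \<psi>, Xs ! 1 \<cdot> \<psi>]) (VFs C E 2)"

text \<open>The first two terms of \<open>d\<phi>(X\<^sub>H, Y\<^sub>H)\<close> are brackets with the zero fields \<open>Y\<^sub>H \<cdot> \<phi>\<close> and \<open>X\<^sub>H \<cdot> \<phi>\<close>.\<close>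

lemma curvature_eq:
  assumes X: "X \<in> VF C E" and Y: "Y \<in> VF C E"
  shows "curvature [X, Y] = (lie C E (X \<cdot> \<psi>) (Y \<cdot> \<psi>) \<cdot> \<phi>) \<cdot> tneg C E"
proof -
  have n: "tzero C E \<cdot> tneg C E = tzero C E"
    using VF_group_inv[of "tzero C E" E] vf.inv_one by simp
  have "curvature [X, Y] = ext_deriv C E 1 (map_form C E \<phi>) [X \<cdot> \<psi>, Y \<cdot> \<psi>]"
    using X Y by (simp add: curvature_def)
  also have "\<dots> = fplus C E (fplus C E (tzero C E) (tzero C E))
      ((lie C E (X \<cdot> \<psi>) (Y \<cdot> \<psi>) \<cdot> \<phi>) \<cdot> tneg C E)"
    using X Y n by (subst ext_deriv_rank_1) (simp_all add: lie_zero)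
  finally show ?thesis
    using X Y vf.l_one[of "tzero C E"]
      vf.l_one[of "(lie C E (X \<cdot> \<psi>) (Y \<cdot> \<psi>) \<cdot> \<phi>) \<cdot> tneg C E"] by simp
qed

lemma neg_add:
  "X \<in> VF C E \<Longrightarrow> Y \<in> VF C E \<Longrightarrow>
    fplus C E X Y \<cdot> tneg C E = fplus C E (X \<cdot> tneg C E) (Y \<cdot> tneg C E)"
  using vf.inv_mult[of X Y] by (simp add: VF_group_inv)

lemma curvature_form: "curvature \<in> forms C E 2"
  unfolding forms_def
proof (intro CollectI conjI ballI allI impI)
  show "(1::nat) \<le> 2" by simp
  show "curvature \<in> VFs C E 2 \<rightarrow>\<^sub>E VF C E"
  proof (intro PiE_I)
    fix Xs assume "Xs \<in> VFs C E 2"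
    then show "curvature Xs \<in> VF C E"
      by (elim VFs_2E) (simp only: curvature_eq \<phi>_VF \<psi>_VF lie_in_VF neg_in_VF)
  qed (simp add: curvature_def)
next
  fix Xs i Y assume Xs: "Xs \<in> VFs C E 2" and i: "i < (2::nat)" and Y: "Y \<in> VF C E"
  obtain X1 X2 where X: "Xs = [X1, X2]" "X1 \<in> VF C E" "X2 \<in> VF C E"
    using Xs by (rule VFs_2E)
  have "i = 0 \<or> i = 1" using i by auto
  then show "curvature (Xs[i := fplus C E (Xs ! i) Y]) = fplus C E (curvature Xs) (curvature (Xs[i := Y]))"
    using X Y by (auto simp: curvature_eq \<psi>_add lie_add_left lie_add_right \<phi>_add neg_add)
next
  fix Xs \<sigma> assume Xs: "Xs \<in> VFs C E 2" and \<sigma>: "\<sigma> permutes {..<2::nat}"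
  obtain X Y where X: "Xs = [X, Y]" "X \<in> VF C E" "Y \<in> VF C E"
    using Xs by (rule VFs_2E)
  have "curvature [Y, X] = curvature [X, Y] \<cdot> tneg C E"
    using X lie_flip[of "Y \<cdot> \<psi>" E "X \<cdot> \<psi>"]
    by (simp add: curvature_eq neg_\<phi> del: assoc)
  then show "curvature (permute_list \<sigma> Xs) = signed C E (sign \<sigma>) (curvature Xs)"
    using \<sigma> X unfolding permutes_lessThan_2
    by (auto simp: permute_list_2 signed_def sign_swap_id)
qed


lemma form_then_apply:
  "X \<in> VF C E \<Longrightarrow> Y \<in> VF C E \<Longrightarrow> form_then C E 2 f \<omega> [X, Y] = \<omega> [X, Y] \<cdot> f"
  and form_plus_apply:
  "X \<in> VF C E \<Longrightarrow> Y \<in> VF C E \<Longrightarrow> form_plus C E 2 \<omega> \<tau> [X, Y] = fplus C E (\<omega> [X, Y]) (\<tau> [X, Y])"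
  and form_minus_apply:
  "X \<in> VF C E \<Longrightarrow> Y \<in> VF C E \<Longrightarrow>
    form_minus C E 2 \<omega> \<tau> [X, Y] = fplus C E (\<omega> [X, Y]) (\<tau> [X, Y] \<cdot> tneg C E)"
  and half_wedge_self_apply:
  "X \<in> VF C E \<Longrightarrow> Y \<in> VF C E \<Longrightarrow> half_wedge_self C E f [X, Y] = lie C E (X \<cdot> f) (Y \<cdot> f)"
  by (simp_all add: form_then_def form_plus_def form_minus_def half_wedge_self_def)

text \<open>With \<open>P = [X\<^sub>V, Y\<^sub>V]\<close>, \<open>Q = [X\<^sub>V, Y\<^sub>H]\<close>, \<open>R = [X\<^sub>H, Y\<^sub>V]\<close> and \<open>S = [X\<^sub>H, Y\<^sub>H]\<close>, the terms on the right are
  \<open>d\<phi> = (P + R) + (P + Q) - (P + Q\<^sub>V + R\<^sub>V + S\<^sub>V)\<close>, \<open>\<onehalf>[\<phi> \<and> \<phi>] = P\<close>, \<open>[\<phi> \<and> id] = (P + Q) + (P + R)\<close> and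
  \<open>[\<phi> \<and> \<psi>]\<^sub>V = Q\<^sub>V + R\<^sub>V\<close>. The last two are of this form by antisymmetry, and \<open>P\<^sub>V = P\<close> by the closure of
  vertical fields.\<close>

lemma structural_equation:
  "curvature = form_minus C E 2
     (form_plus C E 2 (ext_deriv C E 1 (map_form C E \<phi>)) (half_wedge_self C E \<phi>))
     (form_minus C E 2
       (wedge C E 1 1 (map_form C E \<phi>) (map_form C E (idm C (Tob C E))))
       (form_then C E 2 \<phi> (wedge C E 1 1 (map_form C E \<phi>) (map_form C E \<psi>))))"
  (is "_ = ?rhs")
proof
  fix Xs
  show "curvature Xs = ?rhs Xs"
  proof (cases "Xs \<in> VFs C E 2")
    case False
    then show ?thesis by (simp add: curvature_def form_minus_def)
  next
    case True
    then obtain X Y where Xs: "Xs = [X, Y]" and X: "X \<in> VF C E" and Y: "Y \<in> VF C E"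
      by (rule VFs_2E)
    let ?add = "fplus C E"
    let ?neg = "\<lambda>Z. Z \<cdot> tneg C E"
    define P where "P = lie C E (X \<cdot> \<phi>) (Y \<cdot> \<phi>)"
    define Q where "Q = lie C E (X \<cdot> \<phi>) (Y \<cdot> \<psi>)"
    define R where "R = lie C E (X \<cdot> \<psi>) (Y \<cdot> \<phi>)"
    define S where "S = lie C E (X \<cdot> \<psi>) (Y \<cdot> \<psi>)"
    have [simp]: "P \<in> VF C E" "Q \<in> VF C E" "R \<in> VF C E" "S \<in> VF C E"
      using X Y by (simp_all add: P_def Q_def R_def S_def)
    have P\<phi>: "P \<cdot> \<phi> = P"
      using vertical_closed[OF X Y] by (simp add: P_def)
    have XYV: "lie C E X (Y \<cdot> \<phi>) = ?add P R"
      using lie_add_left[of "X \<cdot> \<phi>" E "X \<cdot> \<psi>" "Y \<cdot> \<phi>"] X Y by (simp add: P_def R_def split_form)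
    have XVY: "lie C E (X \<cdot> \<phi>) Y = ?add P Q"
      using lie_add_right[of "X \<cdot> \<phi>" E "Y \<cdot> \<phi>" "Y \<cdot> \<psi>"] X Y by (simp add: P_def Q_def split_form)
    have XHY: "lie C E (X \<cdot> \<psi>) Y = ?add R S"
      using lie_add_right[of "X \<cdot> \<psi>" E "Y \<cdot> \<phi>" "Y \<cdot> \<psi>"] X Y by (simp add: R_def S_def split_form)
    have XY: "lie C E X Y = ?add (?add P Q) (?add R S)"
      using lie_add_left[of "X \<cdot> \<phi>" E "X \<cdot> \<psi>" Y] X Y by (simp add: XVY XHY split_form)
    have flips: "?neg (lie C E Y (X \<cdot> \<phi>)) = ?add P Q" "?neg (lie C E (Y \<cdot> \<phi>) X) = ?add P R"
      "?neg (lie C E (Y \<cdot> \<phi>) (X \<cdot> \<psi>)) = R"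
      using X Y lie_flip[of "X \<cdot> \<phi>" E Y] lie_flip[of X E "Y \<cdot> \<phi>"] lie_flip[of "X \<cdot> \<psi>" E "Y \<cdot> \<phi>"]
      by (simp_all add: XVY XYV R_def)
    let ?A = "?add (?add P R) (?add P Q)" and ?B = "?add (Q \<cdot> \<phi>) (R \<cdot> \<phi>)"
    have "ext_deriv C E 1 (map_form C E \<phi>) [X, Y]
        = ?add ?A (?neg (lie C E X Y \<cdot> \<phi>))"
      using X Y by (subst ext_deriv_rank_1) (simp_all add: XYV flips del: assoc)
    also have "lie C E X Y \<cdot> \<phi> = ?add P (?add ?B (S \<cdot> \<phi>))"
      using vf.m_assoc by (simp add: XY \<phi>_add P\<phi>)
    finally have d: "ext_deriv C E 1 (map_form C E \<phi>) [X, Y]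
      = ?add ?A (?neg (?add P (?add ?B (S \<cdot> \<phi>))))" .
    have w1: "wedge C E 1 1 (map_form C E \<phi>) (map_form C E (idm C (Tob C E))) [X, Y] = ?A"
    proof -
      have id: "Z \<cdot> idm C (Tob C E) = Z" if "Z \<in> VF C E" for Z
        using that by (simp add: VF_iff)
      have "wedge C E 1 1 (map_form C E \<phi>) (map_form C E (idm C (Tob C E))) [X, Y]
        = ?add (?add P Q) (?add P R)"
        using X Y by (subst wedge_rank_1_1) (simp_all add: id XVY flips del: assoc)
      then show ?thesis
        using vf.m_comm[of "?add P Q" "?add P R"] by simp
    qed
    have w2: "wedge C E 1 1 (map_form C E \<phi>) (map_form C E \<psi>) [X, Y] = ?add Q R"
      using X Y by (subst wedge_rank_1_1) (simp_all add: flips Q_def del: assoc)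
    have "?rhs [X, Y] = ?add (?add (?add ?A (?neg (?add P (?add ?B (S \<cdot> \<phi>))))) P)
        (?neg (?add ?A (?neg ?B)))"
      using X Y d w1 w2
      by (simp add: form_minus_apply form_plus_apply form_then_apply half_wedge_self_apply
          \<phi>_add P_def[symmetric] del: assoc One_nat_def)
    also have "\<dots> = ?neg (S \<cdot> \<phi>)"
      using vf.inverse_sum_cancel[of ?A ?B P "S \<cdot> \<phi>"] by (simp add: VF_group_inv)
    finally show ?thesis
      using X Y by (simp add: Xs curvature_eq S_def)
  qed
qed

end

section \<open>The connection forms of an Ehresmann connection\<close>

context tangent_category_with_negatives
begin

text \<open>Since \<open>\<iota>\<close> is the kernel of \<open>T q\<close>, a field is vertical iff it lies over the zero field, iff it
  factors through \<open>\<iota>\<close>, iff \<open>\<phi> = R \<cdot> \<iota>\<close> fixes it. Linearity of \<open>R\<close> gives that of \<open>\<phi>\<close>, and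
  \<open>\<psi> \<cdot> \<phi> = 0\<close> comes from \<open>H \<cdot> R = q\<^sup>F \<cdot> z\<^sup>V\<close>. The lift \<open>l\<^sup>V\<close>, the zero \<open>z\<^sup>V\<close> and \<open>\<pi>\<^sub>q\<close> are definite
  descriptions, so each is first identified with the pairing that satisfies it.\<close>

lemma ehresmann_connection_forms:
  assumes q: "q \<in> Hom C E M"
    and V: "vertical_bundle C q V \<iota> tV" and F: "horizontal_bundle C q F qF tF"
    and conn: "ehresmann_connection C q \<iota> qF tF R H"
  shows "connection_forms C E (R \<cdot> \<iota>) (piq C q qF tF \<cdot> H)"
proof -
  have q: "q \<in> Arr C" "src C q = E" "tgt C q = M" using q by auto
  then have E: "E \<in> Obj C" and M: "M \<in> Obj C" by auto
  have pbV: "is_pullback C (Tar C q) (tzero C M) V \<iota> tV"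
    and pbTV: "is_pullback C (Tar C (Tar C q)) (Tar C (tzero C M)) (Tob C V) (Tar C \<iota>) (Tar C tV)"
    using tangent_pullback_pullback[OF V[unfolded vertical_bundle_def]] q by simp_all
  have pbF: "is_pullback C q (tproj C M) F qF tF"
    using tangent_pullback_pullback(1)[OF F[unfolded horizontal_bundle_def]] q by simp
  have \<iota>: "\<iota> \<in> Arr C" "src C \<iota> = V" "tgt C \<iota> = Tob C E"
    and tV: "tV \<in> Arr C" "src C tV = V" "tgt C tV = M" and sq: "\<iota> \<cdot> Tar C q = tV \<cdot> tzero C M"
    using is_pullbackD[OF pbV] q M by simp_all
  have VO: "V \<in> Obj C" using \<iota> by auto
  \<comment> \<open>The other projection \<open>tV\<close> is determined by \<open>\<iota>\<close>, because the zero section is monic.\<close>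
  have \<iota>_monic: "h = h'" if "h \<in> Arr C" "tgt C h = V" "h' \<in> Arr C" "tgt C h' = V" "h \<cdot> \<iota> = h' \<cdot> \<iota>" for h h'
  proof (rule pullback_jointly_monic[OF pbV that])
    have "(h \<cdot> \<iota>) \<cdot> Tar C q = (h' \<cdot> \<iota>) \<cdot> Tar C q"
      using that by simp
    then have "(h \<cdot> tV) \<cdot> tzero C M = (h' \<cdot> tV) \<cdot> tzero C M"
      using that(1-4) \<iota> tV q M sq by simp
    then show "h \<cdot> tV = h' \<cdot> tV"
      using that tV M by - (rule zero_monic[of M], simp_all)
  qed
  have zV: "zV C q \<iota> \<in> Arr C" "src C (zV C q \<iota>) = E" "tgt C (zV C q \<iota>) = V"
    "zV C q \<iota> \<cdot> \<iota> = tzero C E"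
  proof -
    define h where "h = pair C \<iota> tV (tzero C E) q"
    have h: "h \<in> Arr C" "src C h = E" "tgt C h = V" "h \<cdot> \<iota> = tzero C E"
      using pair_eqs[OF pbV, of "tzero C E" q] q E M by (simp_all add: h_def)
    have "zV C q \<iota> = h"
      unfolding zV_def using h \<iota> q \<iota>_monic by (intro the_equality) auto
    then show "zV C q \<iota> \<in> Arr C" "src C (zV C q \<iota>) = E" "tgt C (zV C q \<iota>) = V"
      "zV C q \<iota> \<cdot> \<iota> = tzero C E"
      using h by auto
  qed
  have T\<iota>_monic: "h = h'"
    if "h \<in> Arr C" "tgt C h = Tob C V" "h' \<in> Arr C" "tgt C h' = Tob C V"
      "h \<cdot> Tar C \<iota> = h' \<cdot> Tar C \<iota>" for h h'
  proof (rule pullback_jointly_monic[OF pbTV that])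
    have Tsq: "Tar C \<iota> \<cdot> Tar C (Tar C q) = Tar C tV \<cdot> Tar C (tzero C M)"
      using sq \<iota> q tV M by (simp flip: Tar_cmp)
    have "(h \<cdot> Tar C \<iota>) \<cdot> Tar C (Tar C q) = (h' \<cdot> Tar C \<iota>) \<cdot> Tar C (Tar C q)"
      using that by simp
    then have "(h \<cdot> (Tar C tV \<cdot> Tar C (tzero C M))) \<cdot> Tar C (tproj C M)
        = (h' \<cdot> (Tar C tV \<cdot> Tar C (tzero C M))) \<cdot> Tar C (tproj C M)"
      using that(1-4) \<iota> tV q M Tsq by simp
    then show "h \<cdot> Tar C tV = h' \<cdot> Tar C tV"
      using that tV M by simp
  qed
  have lV: "lV C q \<iota> \<in> Arr C" "src C (lV C q \<iota>) = V" "tgt C (lV C q \<iota>) = Tob C V"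
    "lV C q \<iota> \<cdot> Tar C \<iota> = \<iota> \<cdot> tlift C E"
  proof -
    define h where "h = pair C (Tar C \<iota>) (Tar C tV) (\<iota> \<cdot> tlift C E) (tV \<cdot> tzero C M)"
    have "(\<iota> \<cdot> tlift C E) \<cdot> Tar C (Tar C q) = (tV \<cdot> tzero C M) \<cdot> Tar C (tzero C M)"
      using \<iota> tV q E M lift_nat[of q M, symmetric] by (simp add: zero_lift cmp_eq_extend[OF sq])
    then have h: "h \<in> Arr C" "src C h = V" "tgt C h = Tob C V" "h \<cdot> Tar C \<iota> = \<iota> \<cdot> tlift C E"
      using pair_eqs[OF pbTV, of "\<iota> \<cdot> tlift C E" "tV \<cdot> tzero C M"] q \<iota> tV E M
      by (simp_all add: h_def)
    have "lV C q \<iota> = h"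
      unfolding lV_def using h \<iota> q T\<iota>_monic by (intro the_equality) auto
    then show "lV C q \<iota> \<in> Arr C" "src C (lV C q \<iota>) = V" "tgt C (lV C q \<iota>) = Tob C V"
      "lV C q \<iota> \<cdot> Tar C \<iota> = \<iota> \<cdot> tlift C E"
      using h by auto
  qed
  have qF: "qF \<in> Arr C" "src C qF = F" "tgt C qF = E"
    using is_pullbackD[OF pbF] q M by simp_all
  have piq: "piq C q qF tF \<in> Arr C" "src C (piq C q qF tF) = Tob C E" "tgt C (piq C q qF tF) = F"
    "piq C q qF tF \<cdot> qF = tproj C E"
  proof -
    define h where "h = pair C qF tF (tproj C E) (Tar C q)"
    have h: "h \<in> Arr C" "src C h = Tob C E" "tgt C h = F" "h \<cdot> qF = tproj C E" "h \<cdot> tF = Tar C q"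
      using pair_eqs[OF pbF, of "tproj C E" "Tar C q"] q E M by (simp_all add: h_def)
    have "piq C q qF tF = h"
      unfolding piq_def using h qF q pullback_jointly_monic[OF pbF]
      by (intro the_equality) auto
    then show "piq C q qF tF \<in> Arr C" "src C (piq C q qF tF) = Tob C E"
      "tgt C (piq C q qF tF) = F" "piq C q qF tF \<cdot> qF = tproj C E"
      using h by auto
  qed
  have R: "R \<in> Arr C" "src C R = Tob C E" "tgt C R = V" "\<iota> \<cdot> R = idm C V"
    "R \<cdot> (\<iota> \<cdot> tproj C E) = tproj C E" "R \<cdot> lV C q \<iota> = tlift C E \<cdot> Tar C R"
    and H: "H \<in> Arr C" "src C H = F" "tgt C H = Tob C E" "H \<cdot> tproj C E = qF"
    and HR: "H \<cdot> R = qF \<cdot> zV C q \<iota>"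
    and split: "fplus C E (R \<cdot> \<iota>) (piq C q qF tF \<cdot> H) = idm C (Tob C E)"
    using conn \<iota> q qF
    by (simp_all add: ehresmann_connection_def vertical_connection_def horizontal_connection_def)
  have fixes_vertical: "X \<cdot> (R \<cdot> \<iota>) = X" if X: "X \<in> VF C E" and Xq: "X \<cdot> Tar C q = q \<cdot> tzero C M" for X
  proof -
    define x where "x = pair C \<iota> tV X q"
    have x: "x \<in> Arr C" "src C x = E" "tgt C x = V" "x \<cdot> \<iota> = X"
      using pair_eqs[OF pbV, of X q] X Xq q M by (simp_all add: x_def VF_iff)
    have "x \<cdot> (\<iota> \<cdot> (R \<cdot> \<iota>)) = x \<cdot> \<iota>"
      using x R \<iota> VO by (simp add: cmp_eq_extend[OF R(4)])
    then have "(x \<cdot> \<iota>) \<cdot> (R \<cdot> \<iota>) = x \<cdot> \<iota>"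
      using x(1-3) R \<iota> by simp
    then show ?thesis by (simp add: x)
  qed
  have vertical: "(X \<cdot> (R \<cdot> \<iota>)) \<cdot> Tar C q = q \<cdot> tzero C M" if X: "X \<in> VF C E" for X
  proof -
    have "R \<cdot> tV = R \<cdot> ((tV \<cdot> tzero C M) \<cdot> tproj C M)"
      using R tV M by simp
    also have "\<dots> = (R \<cdot> (\<iota> \<cdot> tproj C E)) \<cdot> q"
      unfolding sq[symmetric] using R(1-3) \<iota> q E M by simp
    also have "\<dots> = tproj C E \<cdot> q" by (simp add: R)
    finally have RtV: "R \<cdot> tV = tproj C E \<cdot> q" .
    show ?thesis
      using X R \<iota> tV q E M VF_cmp[OF X]
      by (simp add: VF_iff sq cmp_eq_extend[OF RtV])
  qed
  show ?thesis
  proof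
    show "E \<in> Obj C" by (rule E)
    show "R \<cdot> \<iota> \<in> Arr C" "src C (R \<cdot> \<iota>) = Tob C E" "tgt C (R \<cdot> \<iota>) = Tob C E"
      "(R \<cdot> \<iota>) \<cdot> tproj C E = tproj C E"
      using R \<iota> E by simp_all
    show "piq C q qF tF \<cdot> H \<in> Arr C" "src C (piq C q qF tF \<cdot> H) = Tob C E"
      "tgt C (piq C q qF tF \<cdot> H) = Tob C E" "(piq C q qF tF \<cdot> H) \<cdot> tproj C E = tproj C E"
      using piq H E by simp_all
    show "(R \<cdot> \<iota>) \<cdot> tlift C E = tlift C E \<cdot> Tar C (R \<cdot> \<iota>)"
      using R \<iota> E lV by (simp add: cmp_eq_extend[OF R(6)] flip: lV(4))
    show "(piq C q qF tF \<cdot> H) \<cdot> (R \<cdot> \<iota>) = tproj C E \<cdot> tzero C E"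
      using piq H R \<iota> E qF zV by (simp add: cmp_eq_extend[OF HR] cmp_eq_extend[OF piq(4)])
    show "fplus C E (R \<cdot> \<iota>) (piq C q qF tF \<cdot> H) = idm C (Tob C E)"
      by (rule split)
    fix X Y assume X: "X \<in> VF C E" and Y: "Y \<in> VF C E"
    have VF: "Z \<cdot> (R \<cdot> \<iota>) \<in> VF C E" if "Z \<in> VF C E" for Z
      using that R \<iota> E by (simp add: VF_iff)
    show "lie C E (X \<cdot> (R \<cdot> \<iota>)) (Y \<cdot> (R \<cdot> \<iota>)) \<cdot> (R \<cdot> \<iota>) = lie C E (X \<cdot> (R \<cdot> \<iota>)) (Y \<cdot> (R \<cdot> \<iota>))"
      using VF[OF X] VF[OF Y] vertical[OF X] vertical[OF Y] q
      by (intro fixes_vertical lie_VF lie_closed_over_zero) simp_all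
  qed
qed

end

theorem theorem6p13:
  fixes C :: "('o, 'm) tangent_neg_data" (structure)
    and E M V F :: 'o and q \<iota> tV qF tF R H \<phi> \<psi> :: 'm
  assumes "tangent_category_with_negatives C"
    and "\<forall>A \<in> Obj C. tangent_display_map C (tproj C A)"
    and "q \<in> Hom C E M" and "tangent_display_map C q"
    and "vertical_bundle C q V \<iota> tV"
    and "horizontal_bundle C q F qF tF"
    and "ehresmann_connection C q \<iota> qF tF R H"
    and "\<phi> = R \<cdot> \<iota>" and "\<psi> = piq C q qF tF \<cdot> H"
  shows "(\<forall>X \<in> VF C E. \<forall>Y \<in> VF C E.
            curvature_form C q \<iota> qF tF R H [X, Y]
              = lie C E (X \<cdot> \<psi>) (Y \<cdot> \<psi>) \<cdot> \<phi> \<cdot> tneg C E) \<and>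
         curvature_form C q \<iota> qF tF R H \<in> forms C E 2 \<and>
         curvature_form C q \<iota> qF tF R H =
           form_minus C E 2
             (form_plus C E 2 (ext_deriv C E 1 (map_form C E \<phi>)) (half_wedge_self C E \<phi>))
             (form_minus C E 2
               (wedge C E 1 1 (map_form C E \<phi>) (map_form C E (idm C (Tob C E))))
               (form_then C E 2 \<phi> (wedge C E 1 1 (map_form C E \<phi>) (map_form C E \<psi>))))"
proof -
  interpret tangent_category_with_negatives C by fact
  interpret connection_forms C E \<phi> \<psi>
    unfolding assms(8,9) by (rule ehresmann_connection_forms[OF assms(3,5,6,7)])
  have "src C q = E" using assms(3) by (simp add: Hom_def)
  then have "curvature_form C q \<iota> qF tF R H = curvature"
    by (simp add: curvature_form_def curvature_def flip: assms(8,9))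
  then show ?thesis
    using curvature_eq curvature_form structural_equation by simp
qed

end
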